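(* Let $q\in C[-b,b]$ be complex valued, let $f$ be a solution of $f''=qf$ on $[-b,b]$ with $f\neq0$ on $[-b,b]$, $f(0)=1$, and $h:=f'(0)$. Let $n\ge1$ and let $\eta\in C^1[-b,b]$ be such that the functions $u_j$ and $v_j$ given recursively by $$u_0=\eta,\qquad v_0=\eta-\eta(0),$$ $$u_{2i+1}=2\gamma_2\gamma_1[u_{2i}],\qquad v_{2i+1}=2\gamma_2\gamma_1[v_{2i}]+2v_{2i}'(0),$$ $$u_{2i+2}=2\gamma_2\gamma_1[u_{2i+1}]+2u_{2i+1}'(0),\qquad v_{2i+2}=2\gamma_2\gamma_1[v_{2i+1}],\qquad i=0,1,\ldots,$$ are well defined for all $j\le n$. Then the preimages $G_1^{-1}\eta$ and $G_2^{-1}\eta$ are $n$ times continuously differentiable functions, and the following relations hold. If $n$ is even, $$\partial^nG_1^{-1}\eta=G_1^{-1}[u_n]-u_{n-1}'(0),\qquad \partial^nG_2^{-1}\eta=G_2^{-1}[v_n]-2hv_{n-2}'(0)+v_{n-1}'(0);$$ if $n$ is odd, $$\partial^nG_2^{-1}\eta=G_1^{-1}[v_n]-v_{n-1}'(0),\qquad \partial^nG_1^{-1}\eta=G_2^{-1}[u_n]+u_{n-1}'(0)-hu_{n-1}(0).$$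
   Context: $\partial=d/dx$. Kernel: $\mathbf{K}(x,t)=\mathbf{H}\big(\frac{x+t}{2},\frac{x-t}{2}\big)$ on $[-b,b]^2$, where $\mathbf{H}$ is the unique solution of $\frac{\partial^2\mathbf{H}(u,v)}{\partial u\,\partial v}=q(u+v)\mathbf{H}(u,v)$, $\mathbf{H}(u,0)=\frac h2+\frac12\int_0^u q(s)\,ds$, $\mathbf{H}(0,v)=\frac h2$ (equivalently $\mathbf{H}(u,v)=\frac h2+\frac12\int_0^u q(s)\,ds+\int_0^u\int_0^v q(\alpha+\beta)\mathbf{H}(\alpha,\beta)\,d\beta\,d\alpha$). Operators: $G_\pm\eta(x)=\eta(x)+\int_{-x}^x\mathbf{K}(x,t)\left(\eta\left(\frac{t+x}2\right)\pm\eta\left(\frac{t-x}2\right)\right)dt$, $G_1\eta=G_+\left[\eta-\frac{\eta(0)}2\right]+\frac{\eta(0)}2$, $G_2\eta=G_-\eta$. These operators (given by the same formulas on $C[-b,b]$) are invertible; $G_1^{-1}$, $G_2^{-1}$ denote the inverses. Generalized derivative: on $C^1[-b,b]$, $\gamma_2\gamma_1g(x)=\frac12\left(g'(x)-g'(0)-\int_0^xq(s)g(s)\,ds\right)$. The recursion can be continued from $u_j$ (resp. $v_j$) to the next function exactly when $u_j$ (resp. $v_j$) is continuously differentiable on $[-b,b]$; "well defined for $j\le n$" means that it can be carried out up to index $n$. *)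

theory Defs
  imports "HOL-Analysis.Analysis"
begin

text \<open>
  A function on the interval from \<open>-b\<close> to \<open>b\<close> is represented by a function \<open>real \<Rightarrow> complex\<close> of which
  only the values on \<open>{-b..b}\<close> matter. Derivatives are taken within \<open>{-b..b}\<close>, so they are
  one-sided at the end points; \<open>(D b ^^ n) g\<close> is the \<open>n\<close>-th derivative.
\<close>

definition D :: "real \<Rightarrow> (real \<Rightarrow> complex) \<Rightarrow> real \<Rightarrow> complex" where
  "D b g x = vector_derivative g (at x within {-b..b})"

definition C_diff :: "real \<Rightarrow> nat \<Rightarrow> (real \<Rightarrow> complex) \<Rightarrow> bool" where
  "C_diff b n g \<longleftrightarrow>
     (\<forall>k<n. (D b ^^ k) g differentiable_on {-b..b}) \<and> continuous_on {-b..b} ((D b ^^ n) g)"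

text \<open>
  Integrals \<open>LBINT t=a..c\<close> are oriented, as needed for negative \<open>x\<close> below.

  The kernel \<open>K x t\<close> is needed for \<open>x\<close> and \<open>t\<close> in \<open>{-b..b}\<close>, which corresponds to
  \<open>\<bar>u\<bar> + \<bar>v\<bar> \<le> b\<close> in the variables \<open>u = (x + t) / 2\<close>, \<open>v = (x - t) / 2\<close>. The Goursat problem is
  posed classically on this closed square: \<open>Hv\<close> is the partial derivative of \<open>H\<close> in \<open>v\<close>, and its
  derivative in \<open>u\<close> is \<open>q (u + v) * H u v\<close>; both are one-sided at the boundary.
\<close>

definition goursat_solution ::
  "real \<Rightarrow> (real \<Rightarrow> complex) \<Rightarrow> complex \<Rightarrow> (real \<Rightarrow> real \<Rightarrow> complex) \<Rightarrow> bool" where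
  "goursat_solution b q h H \<longleftrightarrow>
     continuous_on {(u, v). \<bar>u\<bar> + \<bar>v\<bar> \<le> b} (\<lambda>(u, v). H u v) \<and>
     (\<exists>Hv. \<forall>u v. \<bar>u\<bar> + \<bar>v\<bar> \<le> b \<longrightarrow>
        ((\<lambda>s. H u s) has_vector_derivative Hv u v) (at v within {s. \<bar>u\<bar> + \<bar>s\<bar> \<le> b}) \<and>
        ((\<lambda>r. Hv r v) has_vector_derivative q (u + v) * H u v) (at u within {r. \<bar>r\<bar> + \<bar>v\<bar> \<le> b})) \<and>
     (\<forall>u\<in>{-b..b}. H u 0 = h / 2 + (LBINT s=0..u. q s) / 2) \<and>
     (\<forall>v\<in>{-b..b}. H 0 v = h / 2)"

definition kernel_K :: "(real \<Rightarrow> real \<Rightarrow> complex) \<Rightarrow> real \<Rightarrow> real \<Rightarrow> complex" where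
  "kernel_K H x t = H ((x + t) / 2) ((x - t) / 2)"

definition G_plus :: "(real \<Rightarrow> real \<Rightarrow> complex) \<Rightarrow> (real \<Rightarrow> complex) \<Rightarrow> real \<Rightarrow> complex" where
  "G_plus K \<eta> x = \<eta> x + (LBINT t=-x..x. K x t * (\<eta> ((t + x) / 2) + \<eta> ((t - x) / 2)))"

definition G_minus :: "(real \<Rightarrow> real \<Rightarrow> complex) \<Rightarrow> (real \<Rightarrow> complex) \<Rightarrow> real \<Rightarrow> complex" where
  "G_minus K \<eta> x = \<eta> x + (LBINT t=-x..x. K x t * (\<eta> ((t + x) / 2) - \<eta> ((t - x) / 2)))"

definition G1 :: "(real \<Rightarrow> real \<Rightarrow> complex) \<Rightarrow> (real \<Rightarrow> complex) \<Rightarrow> real \<Rightarrow> complex" where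
  "G1 K \<eta> x = G_plus K (\<lambda>s. \<eta> s - \<eta> 0 / 2) x + \<eta> 0 / 2"

definition G2 :: "(real \<Rightarrow> real \<Rightarrow> complex) \<Rightarrow> (real \<Rightarrow> complex) \<Rightarrow> real \<Rightarrow> complex" where
  "G2 K \<eta> x = G_minus K \<eta> x"

text \<open>
  The space \<open>C_space b\<close> of continuous functions is made extensional, so that the operators on it can
  be inverted as maps.
\<close>

definition C_space :: "real \<Rightarrow> (real \<Rightarrow> complex) set" where
  "C_space b = {g \<in> extensional {-b..b}. continuous_on {-b..b} g}"

definition inverse_on_C ::
  "real \<Rightarrow> ((real \<Rightarrow> complex) \<Rightarrow> real \<Rightarrow> complex) \<Rightarrow> (real \<Rightarrow> complex) \<Rightarrow> real \<Rightarrow> complex" where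
  "inverse_on_C b G \<eta> =
     inv_into (C_space b) (\<lambda>g. restrict (G g) {-b..b}) (restrict \<eta> {-b..b})"

definition G1_inv ::
  "real \<Rightarrow> (real \<Rightarrow> real \<Rightarrow> complex) \<Rightarrow> (real \<Rightarrow> complex) \<Rightarrow> real \<Rightarrow> complex" where
  "G1_inv b K = inverse_on_C b (G1 K)"

definition G2_inv ::
  "real \<Rightarrow> (real \<Rightarrow> real \<Rightarrow> complex) \<Rightarrow> (real \<Rightarrow> complex) \<Rightarrow> real \<Rightarrow> complex" where
  "G2_inv b K = inverse_on_C b (G2 K)"

definition gamma21 ::
  "real \<Rightarrow> (real \<Rightarrow> complex) \<Rightarrow> (real \<Rightarrow> complex) \<Rightarrow> real \<Rightarrow> complex" where
  "gamma21 b q g x = (D b g x - D b g 0 - (LBINT s=0..x. q s * g s)) / 2"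

text \<open>
  The recursions below are total; the term with index \<open>Suc j\<close> is meaningful only if the term with
  index \<open>j\<close> is continuously differentiable on \<open>{-b..b}\<close>.
\<close>

fun u_seq ::
  "real \<Rightarrow> (real \<Rightarrow> complex) \<Rightarrow> (real \<Rightarrow> complex) \<Rightarrow> nat \<Rightarrow> real \<Rightarrow> complex" where
  "u_seq b q \<eta> 0 = \<eta>"
| "u_seq b q \<eta> (Suc j) =
     (if even j then (\<lambda>x. 2 * gamma21 b q (u_seq b q \<eta> j) x)
      else (\<lambda>x. 2 * gamma21 b q (u_seq b q \<eta> j) x + 2 * D b (u_seq b q \<eta> j) 0))"

fun v_seq ::
  "real \<Rightarrow> (real \<Rightarrow> complex) \<Rightarrow> (real \<Rightarrow> complex) \<Rightarrow> nat \<Rightarrow> real \<Rightarrow> complex" where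
  "v_seq b q \<eta> 0 = (\<lambda>x. \<eta> x - \<eta> 0)"
| "v_seq b q \<eta> (Suc j) =
     (if even j then (\<lambda>x. 2 * gamma21 b q (v_seq b q \<eta> j) x + 2 * D b (v_seq b q \<eta> j) 0)
      else (\<lambda>x. 2 * gamma21 b q (v_seq b q \<eta> j) x))"

end

theory Submission
  imports Defs
begin

text \<open>
  In the characteristic coordinates \<open>u = (x + t) / 2\<close>, \<open>v = (x - t) / 2\<close> the operators \<open>G_plus\<close> and
  \<open>G_minus\<close> become
    \<open>G \<epsilon> g(x) = g(x) + 2 \<integral> H(u, v) (g(u) + \<epsilon> g(- v))\<close>, \<open>\<epsilon> = 1\<close> or \<open>\<epsilon> = - 1\<close>,
  with the integral taken along the segment \<open>u + v = x\<close>. Differentiating in \<open>x\<close> and inserting the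
  Goursat problem for \<open>H\<close> yields the commutation relation \<open>G_eq_prim\<close>:
    \<open>(G \<epsilon> g)' - \<integral> q G \<epsilon> g = G (- \<epsilon>) g' + g(0) (h + \<epsilon> h + \<epsilon> \<integral> q)\<close>.
  The sign changes because the derivative of \<open>g(- v)\<close> is \<open>- g'(- v)\<close>, and the integral of \<open>q G \<epsilon> g\<close>
  appears because \<open>\<partial>\<^sub>u \<partial>\<^sub>v H = q H\<close>. The left-hand side is, up to constants, twice \<open>\<gamma>\<^sub>2\<gamma>\<^sub>1\<close> of \<open>G \<epsilon> g\<close>.
  Hence, up to constants, the derivative of \<open>G1_inv \<eta>\<close> is \<open>G2_inv\<close> of \<open>2 \<gamma>\<^sub>2\<gamma>\<^sub>1 \<eta>\<close> and the derivative of
  \<open>G2_inv \<eta>\<close> is \<open>G1_inv\<close> of it; the constants in \<open>G1\<close> and in the two recursions are such that the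
  formulas become exact (\<open>G1_inv_derivative\<close>, \<open>G2_inv_derivative\<close>). The theorem follows by induction.

  The relation presupposes that the preimage is \<open>C\<^sup>1\<close>. This is obtained without differentiating an
  inverse. The operators are bijective on continuous functions, being Volterra perturbations of the
  identity (\<open>volterra_unique\<close>, \<open>volterra_solvable\<close>). So the function that ought to be the derivative
  exists and is continuous, and its primitive \<open>g\<close> with the right initial value is \<open>C\<^sup>1\<close>. By the
  commutation relation, the image of \<open>g\<close> differs from \<open>\<eta>\<close> by a solution of \<open>z'' = q z\<close> with zero initial
  values, hence equals \<open>\<eta>\<close>.

  Derivatives under integrals with a variable kernel are handled in integrated form, by the
  fundamental theorem of calculus in one variable and Fubini's theorem on triangles (\<open>prim_slant\<close>) and
  rectangles (\<open>prim_swap\<close>).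
\<close>

section \<open>Integrals along antidiagonal segments\<close>

abbreviation prim :: "(real \<Rightarrow> complex) \<Rightarrow> real \<Rightarrow> complex" where
  "prim f x \<equiv> (LBINT s=0..x. f s)"

text \<open>
  The integral of \<open>m\<close> over the segment \<open>u + v = x\<close> between the coordinate axes, parametrised by \<open>u\<close>,
  that is \<open>\<integral>\<^sub>0\<^sup>x m(s, x - s) ds\<close>. The parameter interval does not depend on \<open>x\<close>, so that the
  orientation for negative \<open>x\<close> and the continuity in \<open>x\<close> come for free.
\<close>

definition slant :: "(real \<Rightarrow> real \<Rightarrow> complex) \<Rightarrow> real \<Rightarrow> complex" where
  "slant m x = x *\<^sub>R integral {0..1} (\<lambda>\<sigma>. m (x * \<sigma>) (x * (1 - \<sigma>)))"

text \<open>
  The square of all \<open>(x, t)\<close> with \<open>\<bar>x\<bar>, \<bar>t\<bar> \<le> b\<close>, seen in the characteristic coordinates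
  \<open>u = (x + t) / 2\<close> and \<open>v = (x - t) / 2\<close>.
\<close>

definition diamond :: "real \<Rightarrow> (real \<times> real) set" where
  "diamond b = {(u, v). \<bar>u\<bar> + \<bar>v\<bar> \<le> b}"

abbreviation cont_diamond :: "real \<Rightarrow> (real \<Rightarrow> real \<Rightarrow> complex) \<Rightarrow> bool" where
  "cont_diamond b m \<equiv> continuous_on (diamond b) (\<lambda>p. m (fst p) (snd p))"

lemma slant_point_abs:
  fixes x \<sigma> :: real
  assumes "\<sigma> \<in> {0..1}"
  shows "\<bar>x * \<sigma>\<bar> + \<bar>x * (1 - \<sigma>)\<bar> = \<bar>x\<bar>"
proof -
  have "\<bar>x * \<sigma>\<bar> + \<bar>x * (1 - \<sigma>)\<bar> = \<bar>x\<bar> * \<sigma> + \<bar>x\<bar> * (1 - \<sigma>)"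
    using assms by (simp add: abs_mult)
  then show ?thesis by (simp add: algebra_simps)
qed

lemma prim_scaled:
  assumes "continuous_on (closed_segment 0 x) f"
  shows "prim f x = x *\<^sub>R integral {0..1} (\<lambda>\<sigma>. f (x * \<sigma>))"
proof -
  have im: "(\<lambda>\<sigma>. x * \<sigma>) ` {0..1} = closed_segment 0 x"
    by (auto simp: closed_segment_def image_iff mult.commute)
  have cont: "continuous_on {0..1} (\<lambda>\<sigma>. f (x * \<sigma>))"
    by (rule continuous_on_compose2[OF assms])
      (use im in \<open>auto intro!: continuous_intros\<close>)
  have "(LBINT \<sigma>=0..1. x *\<^sub>R f (x * \<sigma>)) = (LBINT y=x * 0..x * 1. f y)"
    using interval_integral_substitution_finite[of 0 1 "\<lambda>\<sigma>. x * \<sigma>" "\<lambda>_. x" f]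
    by (auto simp: im assms zero_ereal_def one_ereal_def intro!: derivative_eq_intros)
  moreover have "set_integrable lborel {0..1} (\<lambda>\<sigma>. x *\<^sub>R f (x * \<sigma>))"
    by (intro borel_integrable_atLeastAtMost' continuous_on_scaleR continuous_on_const cont)
  then have "(LBINT \<sigma>=0..1. x *\<^sub>R f (x * \<sigma>)) = integral {0..1} (\<lambda>\<sigma>. x *\<^sub>R f (x * \<sigma>))"
    using interval_integral_eq_integral[of 0 1 "\<lambda>\<sigma>. x *\<^sub>R f (x * \<sigma>)"]
    by (simp add: zero_ereal_def one_ereal_def)
  ultimately show ?thesis by (simp add: zero_ereal_def)
qed

lemma prim_uminus: "prim f (- x) = - prim (\<lambda>s. f (- s)) x"
  using interval_integral_reflect[of 0 "ereal (-x)" f]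
  by (simp add: interval_integral_endpoints_reverse[of "ereal x" 0])

lemma slant_uminus: "slant m (- x) = - slant (\<lambda>u v. m (- u) (- v)) x"
  by (simp add: slant_def)

text \<open>
  On the segment one may use \<open>u + v = x\<close>; this is what moves a factor \<open>q(u + v)\<close> in front of the
  integral as \<open>q(x)\<close>.
\<close>

lemma slant_cong:
  assumes "\<bar>x\<bar> \<le> b"
    and "\<And>u v. \<bar>u\<bar> + \<bar>v\<bar> \<le> b \<Longrightarrow> u + v = x \<Longrightarrow> m u v = m' u v"
  shows "slant m x = slant m' x"
proof -
  have "m (x * \<sigma>) (x * (1 - \<sigma>)) = m' (x * \<sigma>) (x * (1 - \<sigma>))" if "\<sigma> \<in> {0..1}" for \<sigma>
    by (rule assms(2)) (use that assms(1) slant_point_abs[OF that, of x] in \<open>auto simp: algebra_simps\<close>)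
  then show ?thesis unfolding slant_def by (metis (mono_tags, lifting) integral_cong)
qed

lemma slant_integrand_continuous:
  assumes "cont_diamond b m" "\<bar>x\<bar> \<le> b"
  shows "continuous_on {0..1} (\<lambda>\<sigma>. m (x * \<sigma>) (x * (1 - \<sigma>)))"
proof -
  have "(x * \<sigma>, x * (1 - \<sigma>)) \<in> diamond b" if "\<sigma> \<in> {0..1}" for \<sigma>
    using slant_point_abs[OF that, of x] assms(2) by (simp add: diamond_def)
  then show ?thesis
    by (intro continuous_on_compose2[OF assms(1), where f = "\<lambda>\<sigma>. (x * \<sigma>, x * (1 - \<sigma>))", simplified])
      (auto intro!: continuous_intros)
qed

lemma slant_add:
  assumes "cont_diamond b m" "cont_diamond b m'" "\<bar>x\<bar> \<le> b"
  shows "slant (\<lambda>u v. m u v + m' u v) x = slant m x + slant m' x"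
  using slant_integrand_continuous[OF assms(1,3)] slant_integrand_continuous[OF assms(2,3)]
  by (simp add: slant_def integral_add integrable_continuous_real scaleR_add_right)

lemma slant_cmult: "slant (\<lambda>u v. c * m u v) x = c * slant m x"
  by (simp add: slant_def)

lemma slant_diff:
  assumes "cont_diamond b m" "cont_diamond b m'" "\<bar>x\<bar> \<le> b"
  shows "slant (\<lambda>u v. m u v - m' u v) x = slant m x - slant m' x"
  using slant_integrand_continuous[OF assms(1,3)] slant_integrand_continuous[OF assms(2,3)]
  by (simp add: slant_def integral_diff integrable_continuous_real scaleR_diff_right)

lemma slant_eq_prim:
  assumes "cont_diamond b m" "\<bar>x\<bar> \<le> b"
  shows "slant m x = prim (\<lambda>s. m s (x - s)) x"
proof -
  have "continuous_on (closed_segment 0 x) (\<lambda>s. m s (x - s))"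
  proof -
    have "(s, x - s) \<in> diamond b" if "s \<in> closed_segment 0 x" for s
      using that assms(2) by (auto simp: diamond_def closed_segment_eq_real_ivl split: if_splits)
    then show ?thesis
      by (intro continuous_on_compose2[OF assms(1), where f = "\<lambda>s. (s, x - s)", simplified])
        (auto intro!: continuous_intros)
  qed
  from prim_scaled[OF this] show ?thesis by (simp add: slant_def algebra_simps)
qed

lemma slant_swap:
  assumes "cont_diamond b m" "\<bar>x\<bar> \<le> b"
  shows "slant (\<lambda>u v. m v u) x = slant m x"
proof -
  let ?f = "\<lambda>\<sigma>. m (x * \<sigma>) (x * (1 - \<sigma>))"
  have "(?f has_integral integral {0..1} ?f) {0..1}"
    using slant_integrand_continuous[OF assms] integrable_continuous_real by blast
  moreover have "(\<lambda>\<sigma>::real. 1 - \<sigma>) ` {0..1} = {0..1}"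
    by (auto simp: image_iff intro!: bexI[of _ "1 - _"])
  ultimately have "((\<lambda>\<sigma>. ?f (1 - \<sigma>)) has_integral integral {0..1} ?f) {0..1}"
    using has_integral_affinity[of ?f _ 0 1 "-1" 1] by simp
  then show ?thesis by (simp add: slant_def integral_unique)
qed

lemma slant_continuous:
  assumes "cont_diamond b m"
  shows "continuous_on {-b..b} (slant m)"
proof -
  have "(x * \<sigma>, x * (1 - \<sigma>)) \<in> diamond b" if "\<sigma> \<in> {0..1}" "x \<in> {-b..b}" for x \<sigma>
    using slant_point_abs[OF that(1), of x] that(2) by (auto simp: diamond_def)
  then have "continuous_on ({-b..b} \<times> cbox 0 1) (\<lambda>(x, \<sigma>). m (x * \<sigma>) (x * (1 - \<sigma>)))"
    unfolding split_beta
    by (intro continuous_on_compose2[OF assms,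
          where f = "\<lambda>p. (fst p * snd p, fst p * (1 - snd p))", simplified])
      (auto intro!: continuous_intros)
  from integral_continuous_on_param[OF this] show ?thesis
    unfolding slant_def cbox_interval by (intro continuous_intros) 
qed

lemma slant_fst:
  assumes "continuous_on {-b..b} a" "\<bar>x\<bar> \<le> b"
  shows "slant (\<lambda>u v. a u) x = prim a x"
proof -
  have "closed_segment 0 x \<subseteq> {-b..b}"
    using assms(2) by (auto simp: closed_segment_eq_real_ivl split: if_splits)
  then show ?thesis
    by (subst prim_scaled) (auto intro: continuous_on_subset[OF assms(1)] simp: slant_def)
qed

lemma prim_snd_continuous:
  assumes "cont_diamond b m"
  shows "cont_diamond b (\<lambda>u v. prim (m u) v)"
proof -
  have seg: "(u, s) \<in> diamond b" if "(u, v) \<in> diamond b" "s \<in> closed_segment 0 v" for u v s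
    using that by (auto simp: diamond_def closed_segment_eq_real_ivl split: if_splits)
  have scaled: "v * \<sigma> \<in> closed_segment 0 v" if "\<sigma> \<in> {0..1}" for v \<sigma> :: real
    using that by (auto simp: closed_segment_def mult.commute)
  have "prim (m u) v = v *\<^sub>R integral {0..1} (\<lambda>\<sigma>. m u (v * \<sigma>))" if "(u, v) \<in> diamond b" for u v
  proof (rule prim_scaled)
    show "continuous_on (closed_segment 0 v) (m u)"
      by (intro continuous_on_compose2[OF assms, where f = "\<lambda>s. (u, s)", simplified])
        (auto intro!: continuous_intros seg[OF that])
  qed
  moreover have "continuous_on (diamond b)
      (\<lambda>p. snd p *\<^sub>R integral {0..1} (\<lambda>\<sigma>. m (fst p) (snd p * \<sigma>)))"
  proof -
    have "(u, v * \<sigma>) \<in> diamond b" if "(u, v) \<in> diamond b" "\<sigma> \<in> {0..1}" for u v \<sigma>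
      using seg[OF that(1) scaled[OF that(2)]] .
    then have "continuous_on (diamond b \<times> cbox 0 1) (\<lambda>(p, \<sigma>). m (fst p) (snd p * \<sigma>))"
      unfolding split_beta
      by (intro continuous_on_compose2[OF assms,
            where f = "\<lambda>w. (fst (fst w), snd (fst w) * snd w)", simplified])
        (auto intro!: continuous_intros)
    from integral_continuous_on_param[OF this] show ?thesis
      unfolding cbox_interval by (intro continuous_intros)
  qed
  ultimately show ?thesis
    by (subst continuous_on_cong[OF refl]) auto
qed

text \<open>
  Both sides are the integral of \<open>m(s, y - s)\<close> over the triangle \<open>0 \<le> s \<le> y \<le> x\<close>: one iterated
  integral has the inner variable \<open>s\<close>, the other one the inner variable \<open>y\<close>, shifted by \<open>s\<close>.
\<close>

lemma prim_slant_nonneg: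
  assumes m: "cont_diamond b m" and x: "0 \<le> x" "x \<le> b"
  shows "prim (slant m) x = slant (\<lambda>u v. prim (m u) v) x"
proof -
  define S where "S = {(s, y). 0 \<le> s \<and> s \<le> y \<and> y \<le> x}"
  define F where "F p = indicator S p *\<^sub>R m (fst p) (snd p - fst p)" for p
  have "closed S"
    unfolding S_def split_beta by (intro closed_Collect_conj closed_Collect_le continuous_intros)
  moreover have "S \<subseteq> cbox (0, 0) (x, x)" by (auto simp: S_def)
  ultimately have "compact S"
    by (meson bounded_cbox bounded_subset compact_eq_bounded_closed)
  moreover have "continuous_on S (\<lambda>p. m (fst p) (snd p - fst p))"
    using x by (intro continuous_on_compose2[OF m, where f = "\<lambda>p. (fst p, snd p - fst p)", simplified])
      (auto intro!: continuous_intros simp: S_def diamond_def)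
  ultimately have "integrable lborel F"
    using borel_integrable_compact[of S "\<lambda>p. m (fst p) (snd p - fst p)"]
    by (simp add: F_def[abs_def])
  then have "(\<integral>y. (\<integral>s. F (s, y) \<partial>lborel) \<partial>lborel) = (\<integral>s. (\<integral>y. F (s, y) \<partial>lborel) \<partial>lborel)"
    using lborel_pair.Fubini_integral[of "\<lambda>s y. F (s, y)"] by (simp add: lborel_prod)
  moreover have "(\<integral>s. F (s, y) \<partial>lborel) = indicator {0..x} y *\<^sub>R slant m y" for y
  proof (cases "y \<in> {0..x}")
    case True
    then have "(\<integral>s. F (s, y) \<partial>lborel) = (LBINT s:{0..y}. m s (y - s))"
      by (auto simp: F_def S_def set_lebesgue_integral_def indicator_def intro!: Bochner_Integration.integral_cong)
    also have "\<dots> = slant m y"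
      using True x by (subst slant_eq_prim[OF m]) (auto simp: interval_integral_Icc zero_ereal_def)
    finally show ?thesis using True by simp
  next
    case False
    then have "F (s, y) = 0" for s by (auto simp: F_def S_def)
    then show ?thesis using False by simp
  qed
  moreover have "(\<integral>y. F (s, y) \<partial>lborel) = indicator {0..x} s *\<^sub>R prim (m s) (x - s)" for s
  proof (cases "s \<in> {0..x}")
    case True
    have "(\<integral>y. F (s, y) \<partial>lborel) = (\<integral>y. F (s, s + 1 * y) \<partial>lborel)"
      by (subst lborel_integral_real_affine[where c = 1 and t = s]) auto
    also have "\<dots> = (LBINT y:{0..x-s}. m s y)"
      using True 
      by (auto simp: F_def S_def set_lebesgue_integral_def indicator_def intro!: Bochner_Integration.integral_cong)
    also have "\<dots> = prim (m s) (x - s)"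
      using True by (auto simp: interval_integral_Icc zero_ereal_def)
    finally show ?thesis using True by simp
  next
    case False
    then have "F (s, y) = 0" for y by (auto simp: F_def S_def)
    then show ?thesis using False by simp
  qed
  ultimately have "(LBINT y:{0..x}. slant m y) = (LBINT s:{0..x}. prim (m s) (x - s))"
    by (simp add: set_lebesgue_integral_def)
  then show ?thesis
    using x by (subst slant_eq_prim[OF prim_snd_continuous[OF m]])
      (auto simp: interval_integral_Icc zero_ereal_def)
qed

lemma cont_diamond_uminus:
  assumes "cont_diamond b m"
  shows "cont_diamond b (\<lambda>u v. m (- u) (- v))"
  by (intro continuous_on_compose2[OF assms, where f = "\<lambda>p. (- fst p, - snd p)", simplified])
    (auto intro!: continuous_intros simp: diamond_def)

lemma cont_diamond_swap:
  assumes "cont_diamond b m"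
  shows "cont_diamond b (\<lambda>u v. m v u)"
  by (intro continuous_on_compose2[OF assms, where f = "\<lambda>p. (snd p, fst p)", simplified])
    (auto intro!: continuous_intros simp: diamond_def)

lemma prim_slant:
  assumes m: "cont_diamond b m" and x: "\<bar>x\<bar> \<le> b"
  shows "prim (slant m) x = slant (\<lambda>u v. prim (m u) v) x"
proof (cases "0 \<le> x")
  case True
  then show ?thesis using prim_slant_nonneg[OF m] x by auto
next
  case False
  let ?m = "\<lambda>u v. m (- u) (- v)"
  have "prim (slant ?m) (- x) = slant (\<lambda>u v. prim (?m u) v) (- x)"
    using prim_slant_nonneg[OF cont_diamond_uminus[OF m]] False x by auto
  then show ?thesis
    by (simp add: prim_uminus slant_uminus slant_cmult[of "-1", simplified]
        interval_lebesgue_integral_uminus)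
qed

lemma prim_slant':
  assumes m: "cont_diamond b m" and x: "\<bar>x\<bar> \<le> b"
  shows "prim (slant m) x = slant (\<lambda>u v. prim (\<lambda>\<alpha>. m \<alpha> v) u) x"
proof -
  have "prim (slant m) x = prim (slant (\<lambda>u v. m v u)) x"
    by (rule interval_integral_cong, rule slant_swap[OF m, symmetric])
      (use x in \<open>auto simp: einterval_def min_def max_def zero_ereal_def split: if_splits\<close>)
  also have "\<dots> = slant (\<lambda>u v. prim (\<lambda>\<alpha>. m \<alpha> u) v) x"
    by (rule prim_slant[OF cont_diamond_swap[OF m] x])
  also have "\<dots> = slant (\<lambda>u v. prim (\<lambda>\<alpha>. m \<alpha> v) u) x"
    by (rule slant_swap[symmetric, OF _ x])
      (rule prim_snd_continuous[OF cont_diamond_swap[OF m]])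
  finally show ?thesis .
qed

section \<open>Primitives and the product rule\<close>

lemma prim_cong:
  assumes "\<bar>x\<bar> \<le> b" "\<And>s. s \<in> {-b..b} \<Longrightarrow> f s = g s"
  shows "prim f x = prim g x"
  by (rule interval_integral_cong)
    (use assms in \<open>auto simp: einterval_def min_def max_def zero_ereal_def split: if_splits\<close>)

lemma prim_integrable:
  assumes "continuous_on {-b..b} f" "\<bar>x\<bar> \<le> b"
  shows "interval_lebesgue_integrable lborel 0 (ereal x) f"
proof (cases "0 \<le> x")
  case True
  then show ?thesis
    using interval_integrable_continuous_on[of 0 x f] continuous_on_subset[OF assms(1), of "{0..x}"] assms(2)
    by (auto simp: zero_ereal_def)
next
  case False
  then have "interval_lebesgue_integrable lborel (ereal x) (ereal 0) f"
    using interval_integrable_continuous_on[of x 0 f] continuous_on_subset[OF assms(1), of "{x..0}"] assms(2)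
    by auto
  then show ?thesis
    by (simp add: zero_ereal_def interval_integrable_endpoints_reverse[of "ereal x"])
qed

lemma prim_add:
  assumes "continuous_on {-b..b} f" "continuous_on {-b..b} g" "\<bar>x\<bar> \<le> b"
  shows "prim (\<lambda>s. f s + g s) x = prim f x + prim g x"
  using prim_integrable[OF assms(1,3)] prim_integrable[OF assms(2,3)] by simp

lemma prim_diff:
  assumes "continuous_on {-b..b} f" "continuous_on {-b..b} g" "\<bar>x\<bar> \<le> b"
  shows "prim (\<lambda>s. f s - g s) x = prim f x - prim g x"
  using prim_integrable[OF assms(1,3)] prim_integrable[OF assms(2,3)] by simp

lemma prim_has_vector_derivative:
  assumes "continuous_on {-b..b} f" "x \<in> {-b..b}"
  shows "(prim f has_vector_derivative f x) (at x within {-b..b})"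
  using interval_integral_FTC2[of "-b" 0 b f x] assms by (auto simp: zero_ereal_def)

lemma prim_continuous:
  assumes "continuous_on {-b..b} f"
  shows "continuous_on {-b..b} (prim f)"
  using prim_has_vector_derivative[OF assms] continuous_on_vector_derivative by blast

lemma prim_derivative:
  assumes "\<And>s. s \<in> {-b..b} \<Longrightarrow> (F has_vector_derivative f s) (at s within {-b..b})"
    and "continuous_on {-b..b} f" "\<bar>x\<bar> \<le> b"
  shows "prim f x = F x - F 0"
proof -
  have sub: "{min 0 x..max 0 x} \<subseteq> {-b..b}" using assms(3) by auto
  have "(LBINT s=ereal 0..ereal x. f s) = F x - F 0"
  proof (rule interval_integral_FTC_finite)
    show "continuous_on {min 0 x..max 0 x} f"
      using continuous_on_subset[OF assms(2) sub] .
    show "(F has_vector_derivative f s) (at s within {min 0 x..max 0 x})"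
      if "min 0 x \<le> s" "s \<le> max 0 x" for s
      by (rule has_vector_derivative_within_subset[OF assms(1) sub]) (use sub that in force)
  qed
  then show ?thesis by (simp add: zero_ereal_def)
qed

lemma prim_at_0 [simp]: "prim f 0 = 0"
  by (simp add: zero_ereal_def[symmetric] interval_integral_endpoints_same)

lemma diamond_mono: "(u, v) \<in> diamond b \<Longrightarrow> \<bar>s\<bar> \<le> \<bar>u\<bar> \<Longrightarrow> \<bar>t\<bar> \<le> \<bar>v\<bar> \<Longrightarrow> (s, t) \<in> diamond b"
  by (auto simp: diamond_def)

lemma cont_diamond_section:
  assumes "cont_diamond b m" "(u, v) \<in> diamond b"
  shows "continuous_on {-\<bar>u\<bar>..\<bar>u\<bar>} (\<lambda>\<alpha>. m \<alpha> v)"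
  by (intro continuous_on_compose2[OF assms(1), where f = "\<lambda>\<alpha>. (\<alpha>, v)", simplified])
    (auto intro!: continuous_intros diamond_mono[OF assms(2)])

lemma cont_diamond_fst: "continuous_on {-b..b} a \<Longrightarrow> cont_diamond b (\<lambda>u v. a u)"
  by (erule continuous_on_compose2) (auto intro!: continuous_intros simp: diamond_def)

lemma cont_diamond_snd: "continuous_on {-b..b} a \<Longrightarrow> cont_diamond b (\<lambda>u v. a v)"
  by (erule continuous_on_compose2) (auto intro!: continuous_intros simp: diamond_def)

lemma cont_diamond_sum: "continuous_on {-b..b} a \<Longrightarrow> cont_diamond b (\<lambda>u v. a (u + v))"
  by (erule continuous_on_compose2) (auto intro!: continuous_intros simp: diamond_def)

lemma continuous_on_reflect:
  fixes a :: "real \<Rightarrow> 'a::topological_space"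
  shows "continuous_on {-b..b} a \<Longrightarrow> continuous_on {-b..b} (\<lambda>s. a (- s))"
  by (erule continuous_on_compose2) (auto intro!: continuous_intros)

lemma prim_fst_continuous:
  assumes "cont_diamond b m"
  shows "cont_diamond b (\<lambda>u v. prim (\<lambda>\<alpha>. m \<alpha> v) u)"
  using cont_diamond_swap[OF prim_snd_continuous[OF cont_diamond_swap[OF assms]]] .

text \<open>
  Fubini's theorem on the rectangle spanned by the origin and \<open>(u, v)\<close>, with the orientation of both
  sides taken into account by scaling to the unit square.
\<close>

lemma prim_swap:
  assumes m: "cont_diamond b m" and uv: "(u, v) \<in> diamond b"
  shows "prim (\<lambda>\<beta>. prim (\<lambda>\<alpha>. m \<alpha> \<beta>) u) v = prim (\<lambda>\<alpha>. prim (\<lambda>\<beta>. m \<alpha> \<beta>) v) u"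
proof -
  have seg: "closed_segment 0 x \<subseteq> {-\<bar>x\<bar>..\<bar>x\<bar>}" for x :: real
    by (auto simp: closed_segment_eq_real_ivl split: if_splits)
  have scaled: "\<bar>x * \<sigma>\<bar> \<le> \<bar>x\<bar>" if "\<sigma> \<in> {0..1}" for x \<sigma> :: real
    using that by (simp add: abs_mult mult_left_le)
  have inner1: "prim (\<lambda>\<alpha>. m \<alpha> \<beta>) u = u *\<^sub>R integral {0..1} (\<lambda>\<sigma>. m (u * \<sigma>) \<beta>)"
    if "\<bar>\<beta>\<bar> \<le> \<bar>v\<bar>" for \<beta>
    by (intro prim_scaled continuous_on_subset[OF cont_diamond_section[OF m] seg]
        diamond_mono[OF uv]) (use that in auto)
  have inner2: "prim (\<lambda>\<beta>. m \<alpha> \<beta>) v = v *\<^sub>R integral {0..1} (\<lambda>\<tau>. m \<alpha> (v * \<tau>))"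
    if "\<bar>\<alpha>\<bar> \<le> \<bar>u\<bar>" for \<alpha>
    using that uv
    by (intro prim_scaled continuous_on_subset[OF cont_diamond_section[OF cont_diamond_swap[OF m], of v \<alpha>] seg])
      (auto simp: diamond_def)
  have "prim (\<lambda>\<beta>. prim (\<lambda>\<alpha>. m \<alpha> \<beta>) u) v = v *\<^sub>R integral {0..1} (\<lambda>\<tau>. prim (\<lambda>\<alpha>. m \<alpha> (v * \<tau>)) u)"
    using uv by (intro prim_scaled continuous_on_subset[OF
          cont_diamond_section[OF cont_diamond_swap[OF prim_fst_continuous[OF m]], of v u] seg])
      (auto simp: diamond_def)
  also have "\<dots> = v *\<^sub>R integral {0..1} (\<lambda>\<tau>. u *\<^sub>R integral {0..1} (\<lambda>\<sigma>. m (u * \<sigma>) (v * \<tau>)))"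
    by (intro arg_cong[where f = "scaleR v"] integral_cong inner1 scaled)
  also have "\<dots> = u *\<^sub>R v *\<^sub>R integral {0..1} (\<lambda>\<tau>. integral {0..1} (\<lambda>\<sigma>. m (u * \<sigma>) (v * \<tau>)))"
    by simp
  also have "integral {0..1} (\<lambda>\<tau>. integral {0..1} (\<lambda>\<sigma>. m (u * \<sigma>) (v * \<tau>)))
      = integral {0..1} (\<lambda>\<sigma>. integral {0..1} (\<lambda>\<tau>. m (u * \<sigma>) (v * \<tau>)))"
  proof -
    have "continuous_on (cbox (0, 0) (1, 1)) (\<lambda>(\<tau>, \<sigma>). m (u * \<sigma>) (v * \<tau>))"
      unfolding split_beta
      by (intro continuous_on_compose2[OF m, where f = "\<lambda>p. (u * snd p, v * fst p)", simplified])
        (auto intro!: continuous_intros diamond_mono[OF uv] scaled simp: mem_box)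
    from integral_swap_continuous[OF this] show ?thesis by simp
  qed
  also have "u *\<^sub>R v *\<^sub>R \<dots>
      = u *\<^sub>R integral {0..1} (\<lambda>\<sigma>. v *\<^sub>R integral {0..1} (\<lambda>\<tau>. m (u * \<sigma>) (v * \<tau>)))"
    by simp
  also have "\<dots> = u *\<^sub>R integral {0..1} (\<lambda>\<sigma>. prim (\<lambda>\<beta>. m (u * \<sigma>) \<beta>) v)"
    by (intro arg_cong[where f = "scaleR u"] integral_cong inner2[symmetric] scaled)
  also have "\<dots> = prim (\<lambda>\<alpha>. prim (\<lambda>\<beta>. m \<alpha> \<beta>) v) u"
    by (intro prim_scaled[symmetric] continuous_on_subset[OF
          cont_diamond_section[OF prim_snd_continuous[OF m] uv] seg])
  finally show ?thesis .
qed

lemma prim_product: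
  assumes L: "cont_diamond b L" and Lu: "cont_diamond b Lu"
    and L_eq: "\<And>u v. (u, v) \<in> diamond b \<Longrightarrow> L u v = L 0 v + prim (\<lambda>\<alpha>. Lu \<alpha> v) u"
    and k: "\<And>s. s \<in> {-b..b} \<Longrightarrow> (k has_vector_derivative k' s) (at s within {-b..b})"
    and k': "continuous_on {-b..b} k'"
    and uv: "(u, v) \<in> diamond b"
  shows "L u v * k u = L 0 v * k 0 + prim (\<lambda>\<alpha>. Lu \<alpha> v * k \<alpha> + L \<alpha> v * k' \<alpha>) u"
proof -
  let ?J = "{-\<bar>u\<bar>..\<bar>u\<bar>}"
  have J: "?J \<subseteq> {-b..b}" using uv by (auto simp: diamond_def)
  have in_diamond: "(s, v) \<in> diamond b" if "s \<in> ?J" for s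
    using that by (intro diamond_mono[OF uv]) auto
  have cont_Lu: "continuous_on ?J (\<lambda>\<alpha>. Lu \<alpha> v)"
    and cont_L: "continuous_on ?J (\<lambda>\<alpha>. L \<alpha> v)"
    using cont_diamond_section[OF Lu uv] cont_diamond_section[OF L uv] .
  have k_J: "(k has_vector_derivative k' s) (at s within ?J)" if "s \<in> ?J" for s
    using k J that by (meson has_vector_derivative_within_subset subsetD)
  have rhs: "((\<lambda>\<alpha>. L 0 v + prim (\<lambda>\<alpha>. Lu \<alpha> v) \<alpha>) has_vector_derivative Lu s v) (at s within ?J)"
    if "s \<in> ?J" for s
    using has_vector_derivative_add[OF has_vector_derivative_const
        prim_has_vector_derivative[OF cont_Lu that]] by simp
  have L_J: "((\<lambda>\<alpha>. L \<alpha> v) has_vector_derivative Lu s v) (at s within ?J)" if "s \<in> ?J" for s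
    by (rule has_vector_derivative_transform[OF that L_eq[OF in_diamond] rhs[OF that]])
  have "((\<lambda>\<alpha>. L \<alpha> v * k \<alpha>) has_vector_derivative Lu s v * k s + L s v * k' s) (at s within ?J)"
    if "s \<in> ?J" for s
    using has_vector_derivative_mult[OF L_J[OF that] k_J[OF that]] by (simp add: add.commute)
  moreover have "continuous_on ?J k"
    using k_J continuous_on_vector_derivative by blast
  then have "continuous_on ?J (\<lambda>s. Lu s v * k s + L s v * k' s)"
    by (intro continuous_intros cont_Lu cont_L continuous_on_subset[OF k' J])
  ultimately show ?thesis
    using prim_derivative[of "\<bar>u\<bar>" "\<lambda>\<alpha>. L \<alpha> v * k \<alpha>" "\<lambda>s. Lu s v * k s + L s v * k' s" u] by simp
qed

text \<open>
  In the parametrisation \<open>\<integral>\<^sub>0\<^sup>x L(x - s, s) k(x - s) ds\<close> of the segment, \<open>x\<close> enters the integrand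
  only through the first argument of \<open>L\<close>. So the derivative in \<open>x\<close> consists of the boundary term at
  \<open>s = x\<close> and the derivative of \<open>L(u, v) k(u)\<close> in \<open>u\<close>; the derivative of \<open>L\<close> in \<open>v\<close> does not occur.
\<close>

lemma slant_product:
  assumes L: "cont_diamond b L" and Lu: "cont_diamond b Lu"
    and L_eq: "\<And>u v. (u, v) \<in> diamond b \<Longrightarrow> L u v = L 0 v + prim (\<lambda>\<alpha>. Lu \<alpha> v) u"
    and k: "\<And>s. s \<in> {-b..b} \<Longrightarrow> (k has_vector_derivative k' s) (at s within {-b..b})"
    and k': "continuous_on {-b..b} k'"
    and x: "\<bar>x\<bar> \<le> b"
  shows "slant (\<lambda>u v. L u v * k u) x
    = prim (\<lambda>s. L 0 s * k 0) x
      + prim (slant (\<lambda>u v. Lu u v * k u + L u v * k' u)) x"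
proof -
  have kc: "continuous_on {-b..b} k"
    using k continuous_on_vector_derivative by blast
  have M: "cont_diamond b (\<lambda>u v. Lu u v * k u + L u v * k' u)"
    by (intro continuous_intros L Lu cont_diamond_fst kc k')
  have L0: "continuous_on {-b..b} (\<lambda>s. L 0 s * k 0)"
    by (intro continuous_on_mult continuous_on_const
        continuous_on_compose2[OF L, where f = "\<lambda>s. (0, s)", simplified])
      (auto intro!: continuous_intros simp: diamond_def)
  have "slant (\<lambda>u v. L u v * k u) x
      = slant (\<lambda>u v. L 0 v * k 0 + prim (\<lambda>\<alpha>. Lu \<alpha> v * k \<alpha> + L \<alpha> v * k' \<alpha>) u) x"
    by (intro slant_cong[OF x] prim_product[OF L Lu L_eq k k']) (simp_all add: diamond_def)
  also have "\<dots> = slant (\<lambda>u v. L 0 v * k 0) x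
      + slant (\<lambda>u v. prim (\<lambda>\<alpha>. Lu \<alpha> v * k \<alpha> + L \<alpha> v * k' \<alpha>) u) x"
    by (intro slant_add[OF _ _ x] cont_diamond_snd[OF L0] prim_fst_continuous[OF M])
  also have "slant (\<lambda>u v. L 0 v * k 0) x = prim (\<lambda>s. L 0 s * k 0) x"
    using slant_swap[OF cont_diamond_fst[OF L0] x] slant_fst[OF L0 x] by simp
  finally show ?thesis by (simp add: prim_slant'[OF M x])
qed

section \<open>A two-sided Volterra equation\<close>

text \<open>
  For \<open>x > 0\<close> the value at \<open>x\<close> involves \<open>\<phi>\<close> on both \<open>{0..x}\<close> and \<open>{-x..0}\<close>. The operator is still of
  Volterra type, but with respect to the growing intervals \<open>{-x..x}\<close>.
\<close>

definition volterra ::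
  "(real \<Rightarrow> real \<Rightarrow> complex) \<Rightarrow> (real \<Rightarrow> real \<Rightarrow> complex) \<Rightarrow> (real \<Rightarrow> complex) \<Rightarrow> real \<Rightarrow> complex" where
  "volterra A B \<phi> = slant (\<lambda>u v. A u v * \<phi> u + B u v * \<phi> (- v))"

lemma compact_diamond: "compact (diamond b)"
proof -
  have "closed (diamond b)"
    unfolding diamond_def split_beta by (intro closed_Collect_le continuous_intros)
  moreover have "diamond b \<subseteq> cbox (-b, -b) (b, b)" by (auto simp: diamond_def)
  ultimately show ?thesis
    by (meson bounded_cbox bounded_subset compact_eq_bounded_closed)
qed

lemma volterra_integrand_continuous:
  assumes "cont_diamond b A" "cont_diamond b B" "continuous_on {-b..b} \<phi>"
  shows "cont_diamond b (\<lambda>u v. A u v * \<phi> u + B u v * \<phi> (- v))"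
  by (intro continuous_intros assms cont_diamond_fst
      cont_diamond_snd[OF continuous_on_reflect[OF assms(3)]])

lemma volterra_continuous:
  assumes "cont_diamond b A" "cont_diamond b B" "continuous_on {-b..b} \<phi>"
  shows "continuous_on {-b..b} (volterra A B \<phi>)"
  unfolding volterra_def by (rule slant_continuous[OF volterra_integrand_continuous[OF assms]])

text \<open>
  Along the segment the two arguments of \<open>\<phi>\<close> have the absolute values \<open>\<bar>x\<bar> \<sigma>\<close> and \<open>\<bar>x\<bar> (1 - \<sigma>)\<close>, and
  integrating \<open>\<bar>x\<bar> exp(l \<bar>x\<bar> \<sigma>)\<close> over the unit interval gains the factor \<open>1 / l\<close>.
\<close>

lemma volterra_weighted_bound:
  assumes "cont_diamond b A" "cont_diamond b B" "continuous_on {-b..b} \<phi>"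
    and A: "\<And>p. p \<in> diamond b \<Longrightarrow> norm (A (fst p) (snd p)) \<le> M"
    and B: "\<And>p. p \<in> diamond b \<Longrightarrow> norm (B (fst p) (snd p)) \<le> M"
    and \<phi>: "\<And>s. \<bar>s\<bar> \<le> b \<Longrightarrow> norm (\<phi> s) \<le> C * exp (l * \<bar>s\<bar>)"
    and "0 < l" "0 \<le> C" "0 \<le> M" and x: "\<bar>x\<bar> \<le> b"
  shows "norm (volterra A B \<phi> x) \<le> 2 * M * C / l * exp (l * \<bar>x\<bar>)"
proof -
  let ?f = "\<lambda>\<sigma>. A (x * \<sigma>) (x * (1 - \<sigma>)) * \<phi> (x * \<sigma>)
      + B (x * \<sigma>) (x * (1 - \<sigma>)) * \<phi> (- (x * (1 - \<sigma>)))"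
  let ?g = "\<lambda>\<sigma>. M * C * (exp (l * \<bar>x\<bar> * \<sigma>) + exp (l * \<bar>x\<bar> * (1 - \<sigma>)))"
  let ?G = "\<lambda>\<sigma>. M * C / l * (exp (l * \<bar>x\<bar> * \<sigma>) - exp (l * \<bar>x\<bar> * (1 - \<sigma>)))"
  have int: "((\<lambda>\<sigma>. \<bar>x\<bar> * ?g \<sigma>) has_integral ?G 1 - ?G 0) {0..1}"
    using \<open>0 < l\<close>
    by (intro fundamental_theorem_of_calculus)
      (auto intro!: derivative_eq_intros simp: has_real_derivative_iff_has_vector_derivative[symmetric] field_simps)
  have bound: "norm (?f \<sigma>) \<le> ?g \<sigma>" if \<sigma>: "\<sigma> \<in> {0..1}" for \<sigma>
  proof -
    have p: "(x * \<sigma>, x * (1 - \<sigma>)) \<in> diamond b"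
      using slant_point_abs[OF \<sigma>, of x] x by (simp add: diamond_def)
    have "norm (A (x * \<sigma>) (x * (1 - \<sigma>)) * \<phi> (x * \<sigma>)) \<le> M * (C * exp (l * \<bar>x * \<sigma>\<bar>))"
      unfolding norm_mult using A[OF p] \<phi>[of "x * \<sigma>"] p \<open>0 \<le> M\<close> \<open>0 \<le> C\<close>
      by (intro mult_mono) (auto simp: diamond_def)
    moreover have "norm (B (x * \<sigma>) (x * (1 - \<sigma>)) * \<phi> (- (x * (1 - \<sigma>))))
        \<le> M * (C * exp (l * \<bar>x * (1 - \<sigma>)\<bar>))"
      unfolding norm_mult using B[OF p] \<phi>[of "- (x * (1 - \<sigma>))"] p \<open>0 \<le> M\<close> \<open>0 \<le> C\<close>
      by (intro mult_mono) (auto simp: diamond_def)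
    ultimately have "norm (?f \<sigma>)
        \<le> M * (C * exp (l * \<bar>x * \<sigma>\<bar>)) + M * (C * exp (l * \<bar>x * (1 - \<sigma>)\<bar>))"
      by (rule order_trans[OF norm_triangle_ineq add_mono])
    moreover have "\<bar>x * \<sigma>\<bar> = \<bar>x\<bar> * \<sigma>" "\<bar>x * (1 - \<sigma>)\<bar> = \<bar>x\<bar> * (1 - \<sigma>)"
      using \<sigma> by (auto simp: abs_mult)
    ultimately show ?thesis by (simp only: distrib_left mult.assoc)
  qed
  have "norm (volterra A B \<phi> x) = norm (integral {0..1} (\<lambda>\<sigma>. x *\<^sub>R ?f \<sigma>))"
    by (simp add: volterra_def slant_def)
  also have "\<dots> \<le> integral {0..1} (\<lambda>\<sigma>. \<bar>x\<bar> * ?g \<sigma>)"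
  proof (rule integral_norm_bound_integral)
    show "(\<lambda>\<sigma>. x *\<^sub>R ?f \<sigma>) integrable_on {0..1}"
      using slant_integrand_continuous[OF volterra_integrand_continuous[OF assms(1-3)] x]
      by (intro integrable_continuous_real continuous_on_scaleR continuous_on_const)
    show "(\<lambda>\<sigma>. \<bar>x\<bar> * ?g \<sigma>) integrable_on {0..1}" using int by blast
    show "norm (x *\<^sub>R ?f \<sigma>) \<le> \<bar>x\<bar> * ?g \<sigma>" if "\<sigma> \<in> {0..1}" for \<sigma>
      unfolding norm_scaleR by (intro mult_left_mono bound that) auto
  qed
  also have "\<dots> = 2 * M * C / l * (exp (l * \<bar>x\<bar>) - 1)"
    unfolding integral_unique[OF int] using \<open>0 < l\<close> by (simp add: field_simps)
  also have "\<dots> \<le> 2 * M * C / l * exp (l * \<bar>x\<bar>)"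
    using \<open>0 < l\<close> \<open>0 \<le> C\<close> \<open>0 \<le> M\<close> by (intro mult_left_mono) auto
  finally show ?thesis .
qed

text \<open>
  In the norm with weight \<open>exp(- l \<bar>x\<bar>)\<close> the operator has norm at most \<open>2 M / l\<close>, where \<open>M\<close> bounds both
  kernels; it is a contraction for \<open>l = 4 M\<close>.
\<close>

lemma volterra_contraction:
  assumes A: "cont_diamond b A" and B: "cont_diamond b B"
  obtains l where "0 < l"
    and "\<And>\<phi> \<phi>' C x. continuous_on {-b..b} \<phi> \<Longrightarrow> continuous_on {-b..b} \<phi>' \<Longrightarrow> 0 \<le> C \<Longrightarrow> \<bar>x\<bar> \<le> b \<Longrightarrow>
      (\<And>s. \<bar>s\<bar> \<le> b \<Longrightarrow> norm (\<phi> s - \<phi>' s) \<le> C * exp (l * \<bar>s\<bar>)) \<Longrightarrow>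
      norm (volterra A B \<phi> x - volterra A B \<phi>' x) \<le> C / 2 * exp (l * \<bar>x\<bar>)"
proof -
  obtain MA where MA: "0 < MA" "\<And>p. p \<in> diamond b \<Longrightarrow> norm (A (fst p) (snd p)) \<le> MA"
    using compact_imp_bounded[OF compact_continuous_image[OF A compact_diamond]]
    by (auto simp: bounded_pos)
  obtain MB where MB: "0 < MB" "\<And>p. p \<in> diamond b \<Longrightarrow> norm (B (fst p) (snd p)) \<le> MB"
    using compact_imp_bounded[OF compact_continuous_image[OF B compact_diamond]]
    by (auto simp: bounded_pos)
  define M where "M = max MA MB"
  have M: "0 < M" using MA by (simp add: M_def)
  show thesis
  proof (rule that[of "4 * M"])
    show "0 < 4 * M" using M by simp
    fix \<phi> \<phi>' :: "real \<Rightarrow> complex" and C x :: real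
    assume \<phi>: "continuous_on {-b..b} \<phi>" "continuous_on {-b..b} \<phi>'" and C: "0 \<le> C" and x: "\<bar>x\<bar> \<le> b"
      and le: "\<And>s. \<bar>s\<bar> \<le> b \<Longrightarrow> norm (\<phi> s - \<phi>' s) \<le> C * exp (4 * M * \<bar>s\<bar>)"
    have "volterra A B \<phi> x - volterra A B \<phi>' x = volterra A B (\<lambda>s. \<phi> s - \<phi>' s) x"
      unfolding volterra_def
      using slant_diff[OF volterra_integrand_continuous[OF A B \<phi>(1)]
          volterra_integrand_continuous[OF A B \<phi>(2)] x]
      by (simp add: algebra_simps)
    also have "norm \<dots> \<le> 2 * M * C / (4 * M) * exp (4 * M * \<bar>x\<bar>)"
      by (rule volterra_weighted_bound[OF A B _ _ _ le _ C _ x])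
        (use M MA(2) MB(2) \<phi> in \<open>auto simp: M_def le_max_iff_disj intro!: continuous_intros\<close>)
    finally show "norm (volterra A B \<phi> x - volterra A B \<phi>' x) \<le> C / 2 * exp (4 * M * \<bar>x\<bar>)"
      using M by simp
  qed
qed

lemma volterra_unique:
  assumes b: "0 < b" and A: "cont_diamond b A" and B: "cont_diamond b B"
    and \<phi>: "continuous_on {-b..b} \<phi>" "continuous_on {-b..b} \<phi>'"
    and eq: "\<And>s. s \<in> {-b..b} \<Longrightarrow> \<phi> s + volterra A B \<phi> s = \<phi>' s + volterra A B \<phi>' s"
    and x: "x \<in> {-b..b}"
  shows "\<phi> x = \<phi>' x"
proof -
  obtain l where l: "0 < l"
    and contr: "\<And>\<phi> \<phi>' C x. continuous_on {-b..b} \<phi> \<Longrightarrow> continuous_on {-b..b} \<phi>' \<Longrightarrow> 0 \<le> C \<Longrightarrow> \<bar>x\<bar> \<le> b \<Longrightarrow>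
      (\<And>s. \<bar>s\<bar> \<le> b \<Longrightarrow> norm (\<phi> s - \<phi>' s) \<le> C * exp (l * \<bar>s\<bar>)) \<Longrightarrow>
      norm (volterra A B \<phi> x - volterra A B \<phi>' x) \<le> C / 2 * exp (l * \<bar>x\<bar>)"
    using volterra_contraction[OF A B] by blast
  \<comment> \<open>The weighted norm of the difference is attained; contraction forces it to vanish.\<close>
  let ?d = "\<lambda>s. exp (- (l * \<bar>s\<bar>)) * norm (\<phi> s - \<phi>' s)"
  have "continuous_on {-b..b} ?d" by (intro continuous_intros \<phi>)
  then obtain s0 where s0: "s0 \<in> {-b..b}" and max: "\<And>s. s \<in> {-b..b} \<Longrightarrow> ?d s \<le> ?d s0"
    using continuous_attains_sup[of "{-b..b}" ?d] b by auto
  have "norm (\<phi> s - \<phi>' s) \<le> ?d s0 * exp (l * \<bar>s\<bar>)" if "\<bar>s\<bar> \<le> b" for s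
    using max[of s] that by (simp add: exp_minus field_simps abs_le_iff)
  then have "norm (volterra A B \<phi> s0 - volterra A B \<phi>' s0) \<le> ?d s0 / 2 * exp (l * \<bar>s0\<bar>)"
    using s0 by (intro contr \<phi>) auto
  moreover have "norm (\<phi> s0 - \<phi>' s0) = norm (volterra A B \<phi> s0 - volterra A B \<phi>' s0)"
    using eq[OF s0] by (metis add_diff_cancel_left' add_diff_eq diff_add_cancel norm_minus_commute)
  moreover have "?d s0 / 2 * exp (l * \<bar>s0\<bar>) = norm (\<phi> s0 - \<phi>' s0) / 2"
    by (simp add: exp_minus field_simps)
  ultimately have "norm (\<phi> s0 - \<phi>' s0) \<le> norm (\<phi> s0 - \<phi>' s0) / 2" by metis
  then have "?d s0 = 0" by simp
  with max[OF x] have "norm (\<phi> x - \<phi>' x) \<le> 0"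
    by (simp add: mult_le_0_iff)
  then show ?thesis by simp
qed

text \<open>
  The solution is the fixed point of a contraction on the bounded continuous functions on the line.
  Its unknown is \<open>w = exp(- l \<bar>x\<bar>) \<phi>\<close>, for which the supremum norm is the weighted norm, and functions on
  the interval are extended to the line as constants beyond the end points.
\<close>

lemma volterra_solvable:
  assumes b: "0 < b" and A: "cont_diamond b A" and B: "cont_diamond b B"
    and \<psi>: "continuous_on {-b..b} \<psi>"
  obtains \<phi> where "continuous_on {-b..b} \<phi>"
    and "\<And>x. x \<in> {-b..b} \<Longrightarrow> \<phi> x + volterra A B \<phi> x = \<psi> x"
proof -
  obtain l where l: "0 < l"
    and contr: "\<And>\<phi> \<phi>' C x. continuous_on {-b..b} \<phi> \<Longrightarrow> continuous_on {-b..b} \<phi>' \<Longrightarrow> 0 \<le> C \<Longrightarrow> \<bar>x\<bar> \<le> b \<Longrightarrow>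
      (\<And>s. \<bar>s\<bar> \<le> b \<Longrightarrow> norm (\<phi> s - \<phi>' s) \<le> C * exp (l * \<bar>s\<bar>)) \<Longrightarrow>
      norm (volterra A B \<phi> x - volterra A B \<phi>' x) \<le> C / 2 * exp (l * \<bar>x\<bar>)"
    using volterra_contraction[OF A B] by blast
  define U where "U w s = exp (l * \<bar>s\<bar>) *\<^sub>R apply_bcontfun w s" for w :: "real \<Rightarrow>\<^sub>C complex" and s
  define P where "P w x = exp (- (l * \<bar>x\<bar>)) *\<^sub>R (\<psi> x - volterra A B (U w) x)" for w x
  define T where "T w = Bcontfun (\<lambda>x. P w (max (-b) (min b x)))" for w
  have U: "continuous_on {-b..b} (U w)" for w
    unfolding U_def by (intro continuous_intros) auto
  have P: "continuous_on {-b..b} (P w)" for w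
    unfolding P_def by (intro continuous_intros \<psi> volterra_continuous A B U)
  have "(\<lambda>x. P w (max (-b) (min b x))) \<in> bcontfun" for w
  proof -
    obtain c where "\<And>x. x \<in> {-b..b} \<Longrightarrow> norm (P w x) \<le> c"
      using compact_imp_bounded[OF compact_continuous_image[OF P[of w] compact_Icc]]
      unfolding bounded_iff by blast
    moreover have "continuous_on UNIV (\<lambda>x. P w (max (-b) (min b x)))"
      using b by (intro continuous_on_compose2[OF P]) (auto intro!: continuous_intros)
    ultimately show ?thesis
      using b by (intro bcontfun_normI[where b = c]) auto
  qed
  then have T: "apply_bcontfun (T w) x = P w (max (-b) (min b x))" for w x
    by (simp add: T_def Bcontfun_inverse)
  have "dist (T w) (T w') \<le> 1 / 2 * dist w w'" for w w'
  proof (rule dist_bound)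
    fix x
    define y where "y = max (-b) (min b x)"
    have y: "\<bar>y\<bar> \<le> b" using b by (auto simp: y_def)
    have "norm (U w s - U w' s) \<le> dist w w' * exp (l * \<bar>s\<bar>)" for s
      using dist_bounded[of w s w']
      by (simp add: U_def scaleR_diff_right[symmetric] dist_norm mult.commute)
    then have "norm (volterra A B (U w) y - volterra A B (U w') y) \<le> dist w w' / 2 * exp (l * \<bar>y\<bar>)"
      by (intro contr U y) auto
    then have "exp (- (l * \<bar>y\<bar>)) * norm (volterra A B (U w) y - volterra A B (U w') y) \<le> dist w w' / 2"
      by (simp add: exp_minus field_simps)
    moreover have "P w y - P w' y
        = exp (- (l * \<bar>y\<bar>)) *\<^sub>R (volterra A B (U w') y - volterra A B (U w) y)"
      by (simp add: P_def scaleR_diff_right)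
    ultimately show "dist (apply_bcontfun (T w) x) (apply_bcontfun (T w') x) \<le> 1 / 2 * dist w w'"
      by (simp add: T y_def[symmetric] dist_norm norm_minus_commute)
  qed
  then obtain w where w: "T w = w"
    using banach_fix_type[of "1 / 2" T] by auto
  show thesis
  proof (rule that[OF U])
    fix x assume "x \<in> {-b..b}"
    then have "apply_bcontfun w x = P w x"
      using T[of w x] unfolding w by (simp add: max_absorb2 min_absorb2)
    then have "U w x = \<psi> x - volterra A B (U w) x"
      by (simp add: U_def P_def exp_minus)
    then show "U w x + volterra A B (U w) x = \<psi> x" by simp
  qed
qed

section \<open>The Goursat kernel and the commutation relation\<close>

lemma prim_comb3:
  assumes "continuous_on {-b..b} f" "continuous_on {-b..b} g" "continuous_on {-b..b} k" "\<bar>x\<bar> \<le> b"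
  shows "prim (\<lambda>s. f s + c * g s + d * k s) x = prim f x + c * prim g x + d * prim k x"
proof -
  have "prim (\<lambda>s. f s + c * g s + d * k s) x = prim (\<lambda>s. f s + c * g s) x + prim (\<lambda>s. d * k s) x"
    by (rule prim_add[OF _ _ assms(4)]) (intro continuous_intros assms)+
  also have "prim (\<lambda>s. f s + c * g s) x = prim f x + prim (\<lambda>s. c * g s) x"
    by (rule prim_add[OF _ _ assms(4)]) (intro continuous_intros assms)+
  finally show ?thesis by simp
qed

lemma diamond_coordinates:
  assumes "(u, v) \<in> diamond b"
  shows "u \<in> {-b..b}" "v \<in> {-b..b}"
  using assms by (auto simp: diamond_def)

locale goursat =
  fixes b :: real and q :: "real \<Rightarrow> complex" and h :: complex and H :: "real \<Rightarrow> real \<Rightarrow> complex"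
  assumes b_pos: "0 < b"
    and q_cont: "continuous_on {-b..b} q"
    and solution: "goursat_solution b q h H"
begin

lemma H_cont: "cont_diamond b H"
  using solution by (simp add: goursat_solution_def diamond_def split_beta)

lemma qH_cont: "cont_diamond b (\<lambda>u v. q (u + v) * H u v)"
  by (intro continuous_intros H_cont cont_diamond_sum q_cont)

text \<open>
  The partial derivative \<open>Hv\<close> vanishes on the axis \<open>u = 0\<close>, where \<open>H\<close> is constant. Two applications of
  the fundamental theorem of calculus, first to \<open>Hv\<close> in \<open>u\<close> and then to \<open>H\<close> in \<open>v\<close>, give the claim.
\<close>

lemma H_integral_equation:
  assumes uv: "(u, v) \<in> diamond b"
  shows "H u v = h / 2 + prim q u / 2 + prim (\<lambda>\<beta>. prim (\<lambda>\<alpha>. q (\<alpha> + \<beta>) * H \<alpha> \<beta>) u) v"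
proof -
  obtain Hv where Hv_v: "\<And>u v. (u, v) \<in> diamond b \<Longrightarrow>
        ((\<lambda>s. H u s) has_vector_derivative Hv u v) (at v within {s. \<bar>u\<bar> + \<bar>s\<bar> \<le> b})"
    and Hv_u: "\<And>u v. (u, v) \<in> diamond b \<Longrightarrow>
        ((\<lambda>r. Hv r v) has_vector_derivative q (u + v) * H u v) (at u within {r. \<bar>r\<bar> + \<bar>v\<bar> \<le> b})"
    using solution unfolding goursat_solution_def diamond_def by auto
  have H_u0: "H u 0 = h / 2 + prim q u / 2" if "u \<in> {-b..b}" for u
    using solution that by (simp add: goursat_solution_def)
  have H_0v: "H 0 v = h / 2" if "v \<in> {-b..b}" for v
    using solution that by (simp add: goursat_solution_def)
  have Hv0: "Hv 0 v = 0" if v: "v \<in> {-b..b}" for v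
  proof -
    have edge: "{s. \<bar>0::real\<bar> + \<bar>s\<bar> \<le> b} = {-b..b}" by auto
    have "(0, v) \<in> diamond b" using v by (auto simp: diamond_def)
    from Hv_v[OF this] have "((\<lambda>s. H 0 s) has_vector_derivative Hv 0 v) (at v within {-b..b})"
      unfolding edge .
    moreover have "((\<lambda>s. H 0 s) has_vector_derivative 0) (at v within {-b..b})"
      by (rule has_vector_derivative_transform[OF v H_0v has_vector_derivative_const])
    moreover have "at v within {-b..b} \<noteq> bot"
      using v b_pos by (simp add: trivial_limit_within islimpt_Icc)
    ultimately show ?thesis by (rule vector_derivative_unique_within[rotated])
  qed
  have Hv: "Hv u v = prim (\<lambda>\<alpha>. q (\<alpha> + v) * H \<alpha> v) u" if uv: "(u, v) \<in> diamond b" for u v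
  proof -
    have set: "{r. \<bar>r\<bar> + \<bar>v\<bar> \<le> b} = {-(b - \<bar>v\<bar>)..b - \<bar>v\<bar>}" by auto
    have corner: "(b - \<bar>v\<bar>, v) \<in> diamond b" "\<bar>b - \<bar>v\<bar>\<bar> = b - \<bar>v\<bar>"
      using uv by (auto simp: diamond_def)
    have "prim (\<lambda>\<alpha>. q (\<alpha> + v) * H \<alpha> v) u = Hv u v - Hv 0 v"
    proof (rule prim_derivative[of "b - \<bar>v\<bar>" "\<lambda>r. Hv r v"])
      show "((\<lambda>r. Hv r v) has_vector_derivative q (s + v) * H s v)
          (at s within {-(b - \<bar>v\<bar>)..b - \<bar>v\<bar>})" if "s \<in> {-(b - \<bar>v\<bar>)..b - \<bar>v\<bar>}" for s
      proof -
        have "(s, v) \<in> diamond b" using that by (auto simp: diamond_def)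
        from Hv_u[OF this] show ?thesis unfolding set .
      qed
      show "continuous_on {-(b - \<bar>v\<bar>)..b - \<bar>v\<bar>} (\<lambda>\<alpha>. q (\<alpha> + v) * H \<alpha> v)"
        using cont_diamond_section[OF qH_cont corner(1)] by (simp only: corner(2))
      show "\<bar>u\<bar> \<le> b - \<bar>v\<bar>" using uv by (simp add: diamond_def)
    qed
    then show ?thesis using Hv0[OF diamond_coordinates(2)[OF uv]] by simp
  qed
  have set: "{s. \<bar>u\<bar> + \<bar>s\<bar> \<le> b} = {-(b - \<bar>u\<bar>)..b - \<bar>u\<bar>}" by auto
  have corner: "(b - \<bar>u\<bar>, u) \<in> diamond b" "\<bar>b - \<bar>u\<bar>\<bar> = b - \<bar>u\<bar>"
    using uv by (auto simp: diamond_def)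
  have "prim (\<lambda>\<beta>. prim (\<lambda>\<alpha>. q (\<alpha> + \<beta>) * H \<alpha> \<beta>) u) v = H u v - H u 0"
  proof (rule prim_derivative[of "b - \<bar>u\<bar>" "H u"])
    show "(H u has_vector_derivative prim (\<lambda>\<alpha>. q (\<alpha> + s) * H \<alpha> s) u)
        (at s within {-(b - \<bar>u\<bar>)..b - \<bar>u\<bar>})" if "s \<in> {-(b - \<bar>u\<bar>)..b - \<bar>u\<bar>}" for s
    proof -
      have "(u, s) \<in> diamond b" using that by (auto simp: diamond_def)
      from Hv_v[OF this] show ?thesis unfolding set Hv[OF \<open>(u, s) \<in> diamond b\<close>] .
    qed
    show "continuous_on {-(b - \<bar>u\<bar>)..b - \<bar>u\<bar>} (\<lambda>\<beta>. prim (\<lambda>\<alpha>. q (\<alpha> + \<beta>) * H \<alpha> \<beta>) u)"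
      using cont_diamond_section[OF cont_diamond_swap[OF prim_fst_continuous[OF qH_cont]] corner(1)]
      by (simp add: corner(2))
    show "\<bar>v\<bar> \<le> b - \<bar>u\<bar>" using uv by (auto simp: diamond_def)
  qed
  then show ?thesis using H_u0[OF diamond_coordinates(1)[OF uv]] by simp
qed

lemma H_0: "v \<in> {-b..b} \<Longrightarrow> H 0 v = h / 2"
  using solution by (simp add: goursat_solution_def)

lemma H_u_0: "u \<in> {-b..b} \<Longrightarrow> H u 0 = h / 2 + prim q u / 2"
  using solution by (simp add: goursat_solution_def)

text \<open>
  The partial derivatives of \<open>H\<close>, as they can be read off from the integral equation.
\<close>

definition H_u :: "real \<Rightarrow> real \<Rightarrow> complex" where
  "H_u u v = q u / 2 + prim (\<lambda>\<beta>. q (u + \<beta>) * H u \<beta>) v"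

definition H_v :: "real \<Rightarrow> real \<Rightarrow> complex" where
  "H_v u v = prim (\<lambda>\<alpha>. q (\<alpha> + v) * H \<alpha> v) u"

lemma H_u_cont: "cont_diamond b H_u"
  unfolding H_u_def
  by (intro continuous_on_add cont_diamond_fst continuous_intros q_cont prim_snd_continuous[OF qH_cont]) auto

lemma H_v_cont: "cont_diamond b H_v"
  unfolding H_v_def by (rule prim_fst_continuous[OF qH_cont])

text \<open>
  The Goursat problem asks for \<open>\<partial>\<^sub>u \<partial>\<^sub>v H\<close> only; that \<open>H\<close> can be recovered from \<open>H_u\<close> as well comes from
  exchanging the two integrations in the integral equation.
\<close>

lemma H_eq_prim_H_u:
  assumes uv: "(u, v) \<in> diamond b"
  shows "H u v = H 0 v + prim (\<lambda>\<alpha>. H_u \<alpha> v) u"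
proof -
  have "prim (\<lambda>\<alpha>. H_u \<alpha> v) u
      = prim (\<lambda>\<alpha>. q \<alpha> / 2) u + prim (\<lambda>\<alpha>. prim (\<lambda>\<beta>. q (\<alpha> + \<beta>) * H \<alpha> \<beta>) v) u"
    unfolding H_u_def
  proof (rule prim_add[of "\<bar>u\<bar>"])
    show "continuous_on {-\<bar>u\<bar>..\<bar>u\<bar>} (\<lambda>\<alpha>. q \<alpha> / 2)"
      using uv by (intro continuous_intros continuous_on_subset[OF q_cont]) (auto simp: diamond_def)
  qed (use cont_diamond_section[OF prim_snd_continuous[OF qH_cont] uv] in auto)
  then show ?thesis
    using H_integral_equation[OF uv] prim_swap[OF qH_cont uv] H_0[OF diamond_coordinates(2)[OF uv]]
    by simp
qed

lemma H_eq_prim_H_v: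
  assumes "(u, v) \<in> diamond b"
  shows "H u v = H u 0 + prim (H_v u) v"
  using H_integral_equation[OF assms] H_u_0[OF diamond_coordinates(1)[OF assms]] by (simp add: H_v_def)

text \<open>
  The substitution \<open>u = (x + t) / 2\<close>, \<open>v = (x - t) / 2\<close> splits the integrals in \<open>G_plus\<close> and \<open>G_minus\<close>
  into a part that takes \<open>g\<close> at \<open>(t + x) / 2 = u\<close> and a part that takes it at \<open>(t - x) / 2 = - v\<close>. The two
  operators are \<open>G \<epsilon>\<close> with \<open>\<epsilon> = 1\<close> and \<open>\<epsilon> = - 1\<close>.
\<close>

definition T_right :: "(real \<Rightarrow> complex) \<Rightarrow> real \<Rightarrow> complex" where
  "T_right g = slant (\<lambda>u v. H u v * g u)"

definition T_left :: "(real \<Rightarrow> complex) \<Rightarrow> real \<Rightarrow> complex" where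
  "T_left g = slant (\<lambda>u v. H u v * g (- v))"

definition G :: "complex \<Rightarrow> (real \<Rightarrow> complex) \<Rightarrow> real \<Rightarrow> complex" where
  "G \<epsilon> g x = g x + 2 * (T_right g x + \<epsilon> * T_left g x)"

lemma right_integrand_cont: "continuous_on {-b..b} g \<Longrightarrow> cont_diamond b (\<lambda>u v. H u v * g u)"
  by (intro continuous_intros H_cont cont_diamond_fst)

lemma left_integrand_cont: "continuous_on {-b..b} g \<Longrightarrow> cont_diamond b (\<lambda>u v. H u v * g (- v))"
  by (intro continuous_intros H_cont cont_diamond_snd continuous_on_reflect)

lemma T_right_cont: "continuous_on {-b..b} g \<Longrightarrow> continuous_on {-b..b} (T_right g)"
  unfolding T_right_def by (intro slant_continuous right_integrand_cont)

lemma T_left_cont: "continuous_on {-b..b} g \<Longrightarrow> continuous_on {-b..b} (T_left g)"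
  unfolding T_left_def by (intro slant_continuous left_integrand_cont)

lemma G_cont: "continuous_on {-b..b} g \<Longrightarrow> continuous_on {-b..b} (G \<epsilon> g)"
  unfolding G_def by (intro continuous_intros T_right_cont T_left_cont)

text \<open>
  The double integral that arises from the second term of \<open>H_u\<close> is an integral over a triangle. In the
  other order of integration the potential is constant on the inner segments \<open>u + v = s\<close>, and what
  remains there is \<open>T_right\<close>.
\<close>

lemma slant_H_u:
  assumes g: "continuous_on {-b..b} g" and y: "\<bar>y\<bar> \<le> b"
  shows "slant (\<lambda>u v. H_u u v * g u) y
    = prim (\<lambda>s. q s * g s) y / 2 + prim (\<lambda>s. q s * T_right g s) y"
proof -
  have qg: "continuous_on {-b..b} (\<lambda>u. q u * g u / 2)"
    by (intro continuous_intros q_cont g) auto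
  have M: "cont_diamond b (\<lambda>u v. q (u + v) * H u v * g u)"
    by (intro continuous_intros H_cont cont_diamond_sum q_cont cont_diamond_fst g)
  have "slant (\<lambda>u v. H_u u v * g u) y
      = slant (\<lambda>u v. q u * g u / 2 + prim (\<lambda>\<beta>. q (u + \<beta>) * H u \<beta> * g u) v) y"
    by (simp add: H_u_def distrib_right)
  also have "\<dots> = slant (\<lambda>u v. q u * g u / 2) y + slant (\<lambda>u v. prim (\<lambda>\<beta>. q (u + \<beta>) * H u \<beta> * g u) v) y"
    by (intro slant_add[OF _ _ y] cont_diamond_fst[OF qg] prim_snd_continuous[OF M])
  also have "slant (\<lambda>u v. prim (\<lambda>\<beta>. q (u + \<beta>) * H u \<beta> * g u) v) y
      = prim (slant (\<lambda>u v. q (u + v) * H u v * g u)) y"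
    by (rule prim_slant[OF M y, symmetric])
  also have "\<dots> = prim (\<lambda>s. q s * T_right g s) y"
  proof (rule prim_cong[OF y])
    fix s assume "s \<in> {-b..b}"
    then have "slant (\<lambda>u v. q (u + v) * H u v * g u) s = slant (\<lambda>u v. q s * (H u v * g u)) s"
      by (intro slant_cong[of s b]) auto
    then show "slant (\<lambda>u v. q (u + v) * H u v * g u) s = q s * T_right g s"
      by (simp add: slant_cmult T_right_def)
  qed
  finally show ?thesis using slant_fst[OF qg y] by simp
qed

lemma slant_H_v:
  assumes g: "continuous_on {-b..b} g" and y: "\<bar>y\<bar> \<le> b"
  shows "slant (\<lambda>u v. H_v u v * g (- v)) y = prim (\<lambda>s. q s * T_left g s) y"
proof -
  have M: "cont_diamond b (\<lambda>u v. q (u + v) * H u v * g (- v))"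
    by (intro continuous_intros H_cont cont_diamond_sum q_cont cont_diamond_snd continuous_on_reflect g)
  have "slant (\<lambda>u v. H_v u v * g (- v)) y
      = slant (\<lambda>u v. prim (\<lambda>\<alpha>. q (\<alpha> + v) * H \<alpha> v * g (- v)) u) y"
    by (simp add: H_v_def)
  also have "\<dots> = prim (slant (\<lambda>u v. q (u + v) * H u v * g (- v))) y"
    by (rule prim_slant'[OF M y, symmetric])
  also have "\<dots> = prim (\<lambda>s. q s * T_left g s) y"
  proof (rule prim_cong[OF y])
    fix s assume "s \<in> {-b..b}"
    then have "slant (\<lambda>u v. q (u + v) * H u v * g (- v)) s = slant (\<lambda>u v. q s * (H u v * g (- v))) s"
      by (intro slant_cong[of s b]) auto
    then show "slant (\<lambda>u v. q (u + v) * H u v * g (- v)) s = q s * T_left g s"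
      by (simp add: slant_cmult T_left_def)
  qed
  finally show ?thesis .
qed

lemma T_right_eq_prim:
  assumes g: "\<And>s. s \<in> {-b..b} \<Longrightarrow> (g has_vector_derivative g' s) (at s within {-b..b})"
    and g': "continuous_on {-b..b} g'" and x: "\<bar>x\<bar> \<le> b"
  shows "T_right g x = prim (\<lambda>y. h / 2 * g 0 + prim (\<lambda>s. q s * g s) y / 2
    + prim (\<lambda>s. q s * T_right g s) y + T_right g' y) x"
proof -
  have gc: "continuous_on {-b..b} g" using g continuous_on_vector_derivative by blast
  note conts = continuous_intros prim_continuous q_cont gc g' T_right_cont
  have "T_right g x = prim (\<lambda>s. H 0 s * g 0) x + prim (slant (\<lambda>u v. H_u u v * g u + H u v * g' u)) x"
    unfolding T_right_def using g g' x
    by (intro slant_product[OF H_cont H_u_cont H_eq_prim_H_u]) auto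
  also have "prim (\<lambda>s. H 0 s * g 0) x = prim (\<lambda>s. h / 2 * g 0) x"
    by (rule prim_cong[OF x]) (simp add: H_0)
  also have "prim (slant (\<lambda>u v. H_u u v * g u + H u v * g' u)) x
    = prim (\<lambda>y. prim (\<lambda>s. q s * g s) y / 2 + prim (\<lambda>s. q s * T_right g s) y + T_right g' y) x"
  proof (rule prim_cong[OF x])
    fix y assume "y \<in> {-b..b}"
    then have y: "\<bar>y\<bar> \<le> b" by auto
    have "slant (\<lambda>u v. H_u u v * g u + H u v * g' u) y
        = slant (\<lambda>u v. H_u u v * g u) y + slant (\<lambda>u v. H u v * g' u) y"
      by (intro slant_add[OF _ right_integrand_cont[OF g'] y])
        (intro continuous_intros H_u_cont cont_diamond_fst gc)
    then show "slant (\<lambda>u v. H_u u v * g u + H u v * g' u) y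
        = prim (\<lambda>s. q s * g s) y / 2 + prim (\<lambda>s. q s * T_right g s) y + T_right g' y"
      by (simp add: slant_H_u[OF gc y] T_right_def)
  qed
  also have "prim (\<lambda>s. h / 2 * g 0) x + \<dots>
      = prim (\<lambda>y. h / 2 * g 0 + (prim (\<lambda>s. q s * g s) y / 2 + prim (\<lambda>s. q s * T_right g s) y + T_right g' y)) x"
    by (rule prim_add[symmetric, OF _ _ x]) (intro conts; simp)+
  finally show ?thesis by (simp add: add.assoc)
qed

text \<open>
  This is the mirror image of the previous lemma: with \<open>u\<close> and \<open>v\<close> exchanged, the product rule applies
  to the transposed kernel and to \<open>k(v) = g(- v)\<close>. The chain rule gives the minus sign at \<open>T_left g'\<close>,
  which is why differentiation turns \<open>G \<epsilon>\<close> into \<open>G (- \<epsilon>)\<close>.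
\<close>

lemma T_left_eq_prim:
  assumes g: "\<And>s. s \<in> {-b..b} \<Longrightarrow> (g has_vector_derivative g' s) (at s within {-b..b})"
    and g': "continuous_on {-b..b} g'" and x: "\<bar>x\<bar> \<le> b"
  shows "T_left g x = prim (\<lambda>y. (h / 2 + prim q y / 2) * g 0
    + prim (\<lambda>s. q s * T_left g s) y - T_left g' y) x"
proof -
  have gc: "continuous_on {-b..b} g" using g continuous_on_vector_derivative by blast
  note conts = continuous_intros prim_continuous q_cont gc g' T_left_cont
  have refl_deriv: "((\<lambda>s. g (- s)) has_vector_derivative - g' (- s)) (at s within {-b..b})"
    if "s \<in> {-b..b}" for s
  proof -
    have "uminus ` {-b..b} = {-b..b}" by (auto simp: image_iff intro!: bexI[of _ "- _"])
    then have "(g has_vector_derivative g' (- s)) (at (- s) within uminus ` {-b..b})"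
      using g[of "- s"] that by auto
    then have "((g \<circ> uminus) has_vector_derivative (- 1) *\<^sub>R g' (- s)) (at s within {-b..b})"
      by (rule vector_diff_chain_within[rotated]) (auto intro!: derivative_eq_intros)
    then show ?thesis by (simp add: o_def)
  qed
  have "T_left g x = slant (\<lambda>u v. H v u * g (- u)) x"
    unfolding T_left_def by (rule slant_swap[OF left_integrand_cont[OF gc] x, symmetric])
  also have "\<dots> = prim (\<lambda>s. H s 0 * g (- 0)) x
      + prim (slant (\<lambda>u v. H_v v u * g (- u) + H v u * - g' (- u))) x"
    using continuous_on_minus[OF continuous_on_reflect[OF g']] refl_deriv x
    by (intro slant_product[OF cont_diamond_swap[OF H_cont] cont_diamond_swap[OF H_v_cont] H_eq_prim_H_v])
      (auto simp: diamond_def)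
  also have "prim (\<lambda>s. H s 0 * g (- 0)) x = prim (\<lambda>y. (h / 2 + prim q y / 2) * g 0) x"
    by (rule prim_cong[OF x]) (simp add: H_u_0)
  also have "prim (slant (\<lambda>u v. H_v v u * g (- u) + H v u * - g' (- u))) x
      = prim (\<lambda>y. prim (\<lambda>s. q s * T_left g s) y - T_left g' y) x"
  proof (rule prim_cong[OF x])
    fix y assume "y \<in> {-b..b}"
    then have y: "\<bar>y\<bar> \<le> b" by auto
    have M: "cont_diamond b (\<lambda>u v. H_v u v * g (- v))"
      by (intro continuous_intros H_v_cont cont_diamond_snd continuous_on_reflect gc)
    have "slant (\<lambda>u v. H_v v u * g (- u) + H v u * - g' (- u)) y
        = slant (\<lambda>u v. H_v u v * g (- v) - H u v * g' (- v)) y"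
      using slant_swap[of b "\<lambda>u v. H_v u v * g (- v) - H u v * g' (- v)", OF _ y]
        continuous_on_diff[OF M left_integrand_cont[OF g']] by simp
    also have "\<dots> = slant (\<lambda>u v. H_v u v * g (- v)) y - slant (\<lambda>u v. H u v * g' (- v)) y"
      by (rule slant_diff[OF M left_integrand_cont[OF g'] y])
    finally show "slant (\<lambda>u v. H_v v u * g (- u) + H v u * - g' (- u)) y
        = prim (\<lambda>s. q s * T_left g s) y - T_left g' y"
      by (simp add: slant_H_v[OF gc y] T_left_def)
  qed
  also have "prim (\<lambda>y. (h / 2 + prim q y / 2) * g 0) x + \<dots>
      = prim (\<lambda>y. (h / 2 + prim q y / 2) * g 0 + (prim (\<lambda>s. q s * T_left g s) y - T_left g' y)) x"
    by (rule prim_add[symmetric, OF _ _ x]) (intro conts; simp)+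
  finally show ?thesis by (simp add: add_diff_eq)
qed

text \<open>
  The commutation relation that the theorem rests on. In differentiated form it reads
  \<open>(G \<epsilon> g)' - \<integral> q G \<epsilon> g = G (- \<epsilon>) g' + g(0) (h + \<epsilon> h + \<epsilon> \<integral> q)\<close>. The last term collects the values of
  \<open>2 H\<close> on the two axes, which are \<open>h\<close> and \<open>h + \<integral> q\<close>.
\<close>

lemma G_eq_prim:
  assumes g: "\<And>s. s \<in> {-b..b} \<Longrightarrow> (g has_vector_derivative g' s) (at s within {-b..b})"
    and g': "continuous_on {-b..b} g'" and x: "\<bar>x\<bar> \<le> b"
  shows "G \<epsilon> g x = g 0 + prim (\<lambda>y. G (- \<epsilon>) g' y + prim (\<lambda>s. q s * G \<epsilon> g s) y
    + g 0 * (h + \<epsilon> * h + \<epsilon> * prim q y)) x"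
proof -
  have gc: "continuous_on {-b..b} g" using g continuous_on_vector_derivative by blast
  note conts = continuous_intros prim_continuous q_cont gc g' T_left_cont T_right_cont
  let ?R = "\<lambda>y. h / 2 * g 0 + prim (\<lambda>s. q s * g s) y / 2 + prim (\<lambda>s. q s * T_right g s) y + T_right g' y"
  let ?L = "\<lambda>y. (h / 2 + prim q y / 2) * g 0 + prim (\<lambda>s. q s * T_left g s) y - T_left g' y"
  have "prim (\<lambda>y. G (- \<epsilon>) g' y + prim (\<lambda>s. q s * G \<epsilon> g s) y + g 0 * (h + \<epsilon> * h + \<epsilon> * prim q y)) x
      = prim (\<lambda>y. g' y + 2 * ?R y + (2 * \<epsilon>) * ?L y) x"
  proof (rule prim_cong[OF x])
    fix y assume "y \<in> {-b..b}"
    then have y: "\<bar>y\<bar> \<le> b" by auto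
    have "prim (\<lambda>s. q s * G \<epsilon> g s) y
        = prim (\<lambda>s. q s * g s + 2 * (q s * T_right g s) + (2 * \<epsilon>) * (q s * T_left g s)) y"
      by (simp add: G_def algebra_simps)
    also have "\<dots> = prim (\<lambda>s. q s * g s) y + 2 * prim (\<lambda>s. q s * T_right g s) y
        + (2 * \<epsilon>) * prim (\<lambda>s. q s * T_left g s) y"
      by (rule prim_comb3[OF _ _ _ y]) (intro conts)+
    finally show "G (- \<epsilon>) g' y + prim (\<lambda>s. q s * G \<epsilon> g s) y + g 0 * (h + \<epsilon> * h + \<epsilon> * prim q y)
        = g' y + 2 * ?R y + (2 * \<epsilon>) * ?L y"
      by (simp add: G_def field_simps)
  qed
  also have "\<dots> = prim g' x + 2 * prim ?R x + (2 * \<epsilon>) * prim ?L x"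
    by (rule prim_comb3[OF _ _ _ x]) (intro conts; simp)+
  also have "prim ?R x = T_right g x" by (rule T_right_eq_prim[OF g g' x, symmetric])
  also have "prim ?L x = T_left g x" by (rule T_left_eq_prim[OF g g' x, symmetric])
  also have "prim g' x = g x - g 0" by (rule prim_derivative[OF g g' x])
  finally show ?thesis by (simp add: G_def algebra_simps)
qed

end

section \<open>Invertibility and the derivative of a preimage\<close>

text \<open>
  This is uniqueness for \<open>z'' = q z\<close>, \<open>z(0) = z'(0) = 0\<close>. By the triangle identity the double integral
  equals \<open>\<integral>\<^sub>0\<^sup>x (x - s) q(s) z(s) ds\<close>, a Volterra operator with the kernel \<open>v q(u)\<close>.
\<close>

lemma double_prim_unique:
  assumes b: "0 < b" and q: "continuous_on {-b..b} q" and z: "continuous_on {-b..b} z"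
    and eq: "\<And>x. x \<in> {-b..b} \<Longrightarrow> z x = prim (prim (\<lambda>s. q s * z s)) x"
    and x: "x \<in> {-b..b}"
  shows "z x = 0"
proof -
  let ?A = "\<lambda>u v. - (complex_of_real v * q u)"
  let ?m = "\<lambda>u v::real. q u * z u"
  have A: "cont_diamond b ?A" by (intro continuous_intros cont_diamond_fst q)
  have qz: "continuous_on {-b..b} (\<lambda>s. q s * z s)" by (intro continuous_intros q z)
  have const: "prim (\<lambda>_. c) v = complex_of_real v * c" for c v
    by (subst prim_scaled) (auto simp: scaleR_conv_of_real)
  have "z x + volterra ?A (\<lambda>_ _. 0) z x = 0 + volterra ?A (\<lambda>_ _. 0) (\<lambda>_. 0) x" if "x \<in> {-b..b}" for x
  proof -
    from that have x: "\<bar>x\<bar> \<le> b" by auto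
    have "z x = prim (slant ?m) x"
      unfolding eq[OF that] by (rule prim_cong[OF x]) (use slant_fst[OF qz] in auto)
    also have "\<dots> = slant (\<lambda>u v. prim (?m u) v) x"
      by (rule prim_slant[OF cont_diamond_fst[OF qz] x])
    also have "\<dots> = slant (\<lambda>u v. complex_of_real v * (q u * z u)) x"
      by (simp only: const)
    finally show ?thesis
      using slant_cmult[of "-1" "\<lambda>u v. complex_of_real v * (q u * z u)" x]
      by (simp add: volterra_def mult.assoc slant_def)
  qed
  from volterra_unique[OF b A _ z _ this x] show ?thesis by simp
qed

text \<open>
  The inverse is taken on extensional functions, so \<open>\<phi>\<close> has to be restricted to the interval first;
  \<open>cong\<close> says that \<open>F\<close> does not notice this.
\<close>

lemma inverse_on_C_eq:
  assumes \<phi>: "continuous_on {-b..b} \<phi>" and eq: "\<And>x. x \<in> {-b..b} \<Longrightarrow> F \<phi> x = \<psi> x"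
    and cong: "\<And>\<phi> \<phi>' x. (\<And>s. s \<in> {-b..b} \<Longrightarrow> \<phi> s = \<phi>' s) \<Longrightarrow> continuous_on {-b..b} \<phi> \<Longrightarrow>
      x \<in> {-b..b} \<Longrightarrow> F \<phi> x = F \<phi>' x"
    and inj: "\<And>\<phi> \<phi>' x. continuous_on {-b..b} \<phi> \<Longrightarrow> continuous_on {-b..b} \<phi>' \<Longrightarrow>
      (\<And>s. s \<in> {-b..b} \<Longrightarrow> F \<phi> s = F \<phi>' s) \<Longrightarrow> x \<in> {-b..b} \<Longrightarrow> \<phi> x = \<phi>' x"
    and x: "x \<in> {-b..b}"
  shows "inverse_on_C b F \<psi> x = \<phi> x"
proof -
  let ?R = "\<lambda>g. restrict (F g) {-b..b}"
  let ?\<xi> = "inverse_on_C b F \<psi>"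
  have "restrict \<phi> {-b..b} \<in> C_space b"
    unfolding C_space_def using \<phi> by (auto intro: continuous_on_eq)
  moreover have "?R (restrict \<phi> {-b..b}) = restrict \<psi> {-b..b}"
    using cong[of \<phi> "restrict \<phi> {-b..b}"] \<phi> eq by (auto simp: fun_eq_iff restrict_def)
  ultimately have mem: "restrict \<psi> {-b..b} \<in> ?R ` C_space b" by (metis imageI)
  have "?\<xi> \<in> C_space b"
    unfolding inverse_on_C_def by (rule inv_into_into[OF mem])
  then have "continuous_on {-b..b} ?\<xi>" by (simp add: C_space_def)
  moreover have "?R ?\<xi> = restrict \<psi> {-b..b}"
    unfolding inverse_on_C_def by (rule f_inv_into_f[OF mem])
  then have "F ?\<xi> s = F \<phi> s" if "s \<in> {-b..b}" for s
    using that eq by (metis restrict_apply')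
  ultimately show ?thesis using inj[OF _ \<phi> _ x] by blast
qed

context goursat
begin

lemma kernel_integral:
  assumes g: "continuous_on {-b..b} g" and x: "\<bar>x\<bar> \<le> b"
  shows "(LBINT t=-x..x. kernel_K H x t * (g ((t + x) / 2) + \<epsilon> * g ((t - x) / 2)))
    = 2 * (T_right g x + \<epsilon> * T_left g x)"
proof -
  let ?F = "\<lambda>t. kernel_K H x t * (g ((t + x) / 2) + \<epsilon> * g ((t - x) / 2))"
  \<comment> \<open>The substitution t = x (2 s - 1) turns the interval from -x to x into the unit interval.\<close>
  let ?c = "\<lambda>\<sigma>. x * (2 * \<sigma> - 1)"
  let ?m = "\<lambda>u v. H u v * g u + \<epsilon> * (H u v * g (- v))"
  have im: "?c ` {0..1} \<subseteq> {-\<bar>x\<bar>..\<bar>x\<bar>}"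
  proof
    fix t assume "t \<in> ?c ` {0..1}"
    then obtain \<sigma> where \<sigma>: "t = x * (2 * \<sigma> - 1)" "\<sigma> \<in> {0..1}" by blast
    then have "\<bar>2 * \<sigma> - 1\<bar> \<le> 1" by auto
    with \<sigma>(1) have "\<bar>t\<bar> \<le> \<bar>x\<bar>" by (simp add: abs_mult mult_left_le)
    then show "t \<in> {-\<bar>x\<bar>..\<bar>x\<bar>}" by auto
  qed
  have "continuous_on {-\<bar>x\<bar>..\<bar>x\<bar>} (\<lambda>t. H ((x + t) / 2) ((x - t) / 2))"
    using x
    by (intro continuous_on_compose2[OF H_cont, where f = "\<lambda>t. ((x + t) / 2, (x - t) / 2)", simplified])
      (auto intro!: continuous_intros simp: diamond_def abs_if field_simps)
  moreover have "continuous_on {-\<bar>x\<bar>..\<bar>x\<bar>} (\<lambda>t. g ((t + x) / 2))"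
    "continuous_on {-\<bar>x\<bar>..\<bar>x\<bar>} (\<lambda>t. g ((t - x) / 2))"
    using x by (auto intro!: continuous_on_compose2[OF g] continuous_intros)
  ultimately have "continuous_on {-\<bar>x\<bar>..\<bar>x\<bar>} ?F"
    unfolding kernel_K_def by (intro continuous_intros)
  then have F: "continuous_on (?c ` {0..1}) ?F" by (rule continuous_on_subset[OF _ im])
  have point: "?F (?c \<sigma>) = ?m (x * \<sigma>) (x * (1 - \<sigma>))" for \<sigma>
  proof -
    have "(x + ?c \<sigma>) / 2 = x * \<sigma>" "(x - ?c \<sigma>) / 2 = x * (1 - \<sigma>)"
      "(?c \<sigma> + x) / 2 = x * \<sigma>" "(?c \<sigma> - x) / 2 = - (x * (1 - \<sigma>))"
      by (simp_all add: field_simps)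
    then show ?thesis unfolding kernel_K_def by (simp only: distrib_left mult.left_commute)
  qed
  have cm: "cont_diamond b (\<lambda>u v. \<epsilon> * (H u v * g (- v)))"
    by (intro continuous_on_mult continuous_on_const left_integrand_cont g)
  have m: "cont_diamond b ?m"
    by (intro continuous_on_add right_integrand_cont g cm)
  have "(?c has_real_derivative 2 * x) (at \<sigma> within {0..1})" for \<sigma>
    by (auto intro!: derivative_eq_intros)
  then have "(LBINT t=-x..x. ?F t) = (LBINT \<sigma>=0..1. (2 * x) *\<^sub>R ?F (?c \<sigma>))"
    using interval_integral_substitution_finite[of 0 1 ?c "\<lambda>_. 2 * x" ?F, OF _ _ F]
    by (simp add: zero_ereal_def one_ereal_def)
  also have "\<dots> = (LBINT \<sigma>=0..1. (2 * x) *\<^sub>R ?m (x * \<sigma>) (x * (1 - \<sigma>)))"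
    by (simp only: point)
  also have "\<dots> = integral {0..1} (\<lambda>\<sigma>. (2 * x) *\<^sub>R ?m (x * \<sigma>) (x * (1 - \<sigma>)))"
    using interval_integral_eq_integral[of 0 1 "\<lambda>\<sigma>. (2 * x) *\<^sub>R ?m (x * \<sigma>) (x * (1 - \<sigma>))",
        OF _ borel_integrable_atLeastAtMost'[OF continuous_on_scaleR[OF continuous_on_const
              slant_integrand_continuous[OF m x]]]]
    by (simp add: zero_ereal_def one_ereal_def)
  also have "\<dots> = 2 * slant ?m x"
    unfolding slant_def integral_cmul by (simp add: scaleR_conv_of_real)
  also have "slant ?m x = T_right g x + \<epsilon> * T_left g x"
    using slant_add[OF right_integrand_cont[OF g] cm x] by (simp add: T_right_def T_left_def slant_cmult)
  finally show ?thesis .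
qed

lemma G_plus_eq:
  assumes "continuous_on {-b..b} g" "x \<in> {-b..b}"
  shows "G_plus (kernel_K H) g x = G 1 g x"
  using kernel_integral[OF assms(1), of x 1] assms(2) by (auto simp: G_plus_def G_def)

lemma G_minus_eq:
  assumes "continuous_on {-b..b} g" "x \<in> {-b..b}"
  shows "G_minus (kernel_K H) g x = G (- 1) g x"
  using kernel_integral[OF assms(1), of x "-1"] assms(2) by (auto simp: G_minus_def G_def)

lemma G1_eq:
  assumes "continuous_on {-b..b} g" "x \<in> {-b..b}"
  shows "G1 (kernel_K H) g x = G 1 (\<lambda>s. g s - g 0 / 2) x + g 0 / 2"
  using assms by (simp add: G1_def G_plus_eq continuous_intros)

lemma G2_eq:
  assumes "continuous_on {-b..b} g" "x \<in> {-b..b}"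
  shows "G2 (kernel_K H) g x = G (- 1) g x"
  using assms by (simp add: G2_def G_minus_eq)

lemma G_cong:
  assumes "\<And>s. s \<in> {-b..b} \<Longrightarrow> g s = g' s" "x \<in> {-b..b}"
  shows "G \<epsilon> g x = G \<epsilon> g' x"
proof -
  have "\<bar>x\<bar> \<le> b" using assms(2) by auto
  moreover have "g u = g' u" "g (- v) = g' (- v)" if "\<bar>u\<bar> + \<bar>v\<bar> \<le> b" for u v
    using that by (auto intro!: assms(1))
  ultimately have "T_right g x = T_right g' x" "T_left g x = T_left g' x"
    unfolding T_right_def T_left_def by (auto intro!: slant_cong[of x b])
  then show ?thesis using assms by (simp add: G_def)
qed

lemma G_at_0 [simp]: "G \<epsilon> g 0 = g 0"
  by (simp add: G_def T_right_def T_left_def slant_def)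

lemma zero_mem: "0 \<in> {-b..b}" using b_pos by simp

lemma H_multiple_cont: "cont_diamond b (\<lambda>u v. c * H u v)"
  by (intro continuous_intros H_cont)

lemma G_eq_volterra:
  assumes g: "continuous_on {-b..b} g" and x: "x \<in> {-b..b}"
  shows "G \<epsilon> g x = g x + volterra (\<lambda>u v. 2 * H u v) (\<lambda>u v. 2 * \<epsilon> * H u v) g x"
proof -
  have "volterra (\<lambda>u v. 2 * H u v) (\<lambda>u v. 2 * \<epsilon> * H u v) g x
      = slant (\<lambda>u v. 2 * (H u v * g u) + (2 * \<epsilon>) * (H u v * g (- v))) x"
    by (simp add: volterra_def mult.assoc)
  also have "\<dots> = slant (\<lambda>u v. 2 * (H u v * g u)) x + slant (\<lambda>u v. (2 * \<epsilon>) * (H u v * g (- v))) x"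
    using x by (intro slant_add[of b])
      (auto intro!: continuous_on_mult continuous_on_const right_integrand_cont[OF g] left_integrand_cont[OF g])
  finally show ?thesis
    unfolding slant_cmult G_def T_right_def T_left_def by (simp add: algebra_simps)
qed

lemma G_inj:
  assumes "continuous_on {-b..b} g" "continuous_on {-b..b} g'"
    and "\<And>s. s \<in> {-b..b} \<Longrightarrow> G \<epsilon> g s = G \<epsilon> g' s" "x \<in> {-b..b}"
  shows "g x = g' x"
  by (rule volterra_unique[OF b_pos H_multiple_cont[of 2] H_multiple_cont[of "2 * \<epsilon>"] assms(1,2) _ assms(4)])
    (use assms(3) in \<open>simp add: G_eq_volterra assms(1,2)\<close>)

lemma G_surj:
  assumes "continuous_on {-b..b} \<psi>"
  obtains g where "continuous_on {-b..b} g" "\<And>x. x \<in> {-b..b} \<Longrightarrow> G \<epsilon> g x = \<psi> x"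
  using volterra_solvable[OF b_pos H_multiple_cont[of 2] H_multiple_cont[of "2 * \<epsilon>"] assms] G_eq_volterra
  by metis

text \<open>
  Both \<open>G1\<close> and \<open>G 1\<close> preserve the value at \<open>0\<close>. So the constants by which they differ are known as soon
  as the image is known, and \<open>G1\<close> inherits injectivity and surjectivity from \<open>G 1\<close>.
\<close>

lemma G1_inv_eq:
  assumes g: "continuous_on {-b..b} g"
    and eq: "\<And>x. x \<in> {-b..b} \<Longrightarrow> G1 (kernel_K H) g x = \<psi> x" and x: "x \<in> {-b..b}"
  shows "G1_inv b (kernel_K H) \<psi> x = g x"
  unfolding G1_inv_def
proof (rule inverse_on_C_eq[where F = "G1 (kernel_K H)", OF g eq _ _ x])
  fix g g' :: "real \<Rightarrow> complex" and x
  assume agree: "\<And>s. s \<in> {-b..b} \<Longrightarrow> g s = g' s" and g: "continuous_on {-b..b} g" and x: "x \<in> {-b..b}"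
  have "continuous_on {-b..b} g'" using g agree by (rule continuous_on_eq)
  then show "G1 (kernel_K H) g x = G1 (kernel_K H) g' x"
    using G_cong[of "\<lambda>s. g s - g 0 / 2" "\<lambda>s. g' s - g' 0 / 2" x 1] agree agree[OF zero_mem] g x
    by (simp add: G1_eq)
next
  fix g g' :: "real \<Rightarrow> complex" and x
  assume g: "continuous_on {-b..b} g" "continuous_on {-b..b} g'"
    and same: "\<And>s. s \<in> {-b..b} \<Longrightarrow> G1 (kernel_K H) g s = G1 (kernel_K H) g' s" and x: "x \<in> {-b..b}"
  have "g 0 = g' 0" using same[OF zero_mem] g zero_mem by (simp add: G1_eq)
  moreover have "g x - g 0 / 2 = g' x - g' 0 / 2"
    by (rule G_inj[where \<epsilon> = 1, OF _ _ _ x])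
      (use same g \<open>g 0 = g' 0\<close> in \<open>auto simp: G1_eq intro!: continuous_intros\<close>)
  ultimately show "g x = g' x" by simp
qed auto

lemma G2_inv_eq:
  assumes g: "continuous_on {-b..b} g"
    and eq: "\<And>x. x \<in> {-b..b} \<Longrightarrow> G2 (kernel_K H) g x = \<psi> x" and x: "x \<in> {-b..b}"
  shows "G2_inv b (kernel_K H) \<psi> x = g x"
  unfolding G2_inv_def
proof (rule inverse_on_C_eq[where F = "G2 (kernel_K H)", OF g eq _ _ x])
  fix g g' :: "real \<Rightarrow> complex" and x
  assume agree: "\<And>s. s \<in> {-b..b} \<Longrightarrow> g s = g' s" and g: "continuous_on {-b..b} g" and x: "x \<in> {-b..b}"
  have "continuous_on {-b..b} g'" using g agree by (rule continuous_on_eq)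
  then show "G2 (kernel_K H) g x = G2 (kernel_K H) g' x"
    using G_cong[of g g' x "-1"] agree g x by (simp add: G2_eq)
next
  fix g g' :: "real \<Rightarrow> complex" and x
  assume g: "continuous_on {-b..b} g" "continuous_on {-b..b} g'"
    and same: "\<And>s. s \<in> {-b..b} \<Longrightarrow> G2 (kernel_K H) g s = G2 (kernel_K H) g' s" and x: "x \<in> {-b..b}"
  show "g x = g' x"
    by (rule G_inj[where \<epsilon> = "-1", OF g _ x]) (use same g in \<open>auto simp: G2_eq\<close>)
qed auto

lemma G1_surj:
  assumes \<psi>: "continuous_on {-b..b} \<psi>"
  obtains g where "continuous_on {-b..b} g" "\<And>x. x \<in> {-b..b} \<Longrightarrow> G1 (kernel_K H) g x = \<psi> x"
proof -
  obtain k where k: "continuous_on {-b..b} k" "\<And>x. x \<in> {-b..b} \<Longrightarrow> G 1 k x = \<psi> x - \<psi> 0 / 2"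
    using G_surj[OF continuous_on_diff[OF \<psi> continuous_on_const], of 1 "\<psi> 0 / 2"] by blast
  have k0: "k 0 = \<psi> 0 / 2" using k(2)[OF zero_mem] by simp
  show thesis
  proof (rule that)
    show kc: "continuous_on {-b..b} (\<lambda>x. k x + \<psi> 0 / 2)" by (intro continuous_intros k) auto
    show "G1 (kernel_K H) (\<lambda>x. k x + \<psi> 0 / 2) x = \<psi> x" if "x \<in> {-b..b}" for x
      using k(2)[OF that] by (simp add: G1_eq[OF kc that] k0)
  qed
qed

lemma G2_surj:
  assumes \<psi>: "continuous_on {-b..b} \<psi>"
  obtains g where "continuous_on {-b..b} g" "\<And>x. x \<in> {-b..b} \<Longrightarrow> G2 (kernel_K H) g x = \<psi> x"
  using G_surj[OF \<psi>, of "-1"] G2_eq by metis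

lemma G1_inv_cont:
  assumes "continuous_on {-b..b} \<psi>"
  shows "continuous_on {-b..b} (G1_inv b (kernel_K H) \<psi>)"
proof -
  obtain g where "continuous_on {-b..b} g" "\<And>x. x \<in> {-b..b} \<Longrightarrow> G1 (kernel_K H) g x = \<psi> x"
    using G1_surj[OF assms] by blast
  then show ?thesis using G1_inv_eq[of g \<psi>] by (metis continuous_on_eq)
qed

lemma G2_inv_cont:
  assumes "continuous_on {-b..b} \<psi>"
  shows "continuous_on {-b..b} (G2_inv b (kernel_K H) \<psi>)"
proof -
  obtain g where "continuous_on {-b..b} g" "\<And>x. x \<in> {-b..b} \<Longrightarrow> G2 (kernel_K H) g x = \<psi> x"
    using G2_surj[OF assms] by blast
  then show ?thesis using G2_inv_eq[of g \<psi>] by (metis continuous_on_eq)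
qed

lemma G2_add_const: "G2 K (\<lambda>s. g s + c) x = G2 K g x + c"
  by (simp add: G2_def G_minus_def)

lemma G2_inv_add_const:
  assumes "continuous_on {-b..b} \<psi>" "x \<in> {-b..b}"
  shows "G2_inv b (kernel_K H) (\<lambda>s. \<psi> s + c) x = G2_inv b (kernel_K H) \<psi> x + c"
proof -
  obtain g where g: "continuous_on {-b..b} g" "\<And>x. x \<in> {-b..b} \<Longrightarrow> G2 (kernel_K H) g x = \<psi> x"
    using G2_surj[OF assms(1)] by blast
  have "G2_inv b (kernel_K H) (\<lambda>s. \<psi> s + c) x = g x + c"
    by (rule G2_inv_eq[OF _ _ assms(2)]) (auto simp: G2_add_const g(2) intro!: continuous_intros g(1))
  then show ?thesis using G2_inv_eq[OF g assms(2)] by simp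
qed

text \<open>
  The function \<open>\<eta>\<close> satisfies the equation required of \<open>W\<close>, because the two integrals of \<open>q \<eta>\<close> cancel.
  Hence \<open>W - \<eta>\<close> solves the homogeneous equation \<open>z'' = q z\<close> with zero initial values.
\<close>

lemma eq_if_same_double_prim:
  assumes \<eta>: "\<And>s. s \<in> {-b..b} \<Longrightarrow> (\<eta> has_vector_derivative \<eta>' s) (at s within {-b..b})"
    and \<eta>': "continuous_on {-b..b} \<eta>'" and W: "continuous_on {-b..b} W"
    and eq: "\<And>x. x \<in> {-b..b} \<Longrightarrow>
      W x = \<eta> 0 + prim (\<lambda>y. \<eta>' y - prim (\<lambda>s. q s * \<eta> s) y + prim (\<lambda>s. q s * W s) y) x"
    and x: "x \<in> {-b..b}"
  shows "W x = \<eta> x"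
proof -
  have \<eta>c: "continuous_on {-b..b} \<eta>" using \<eta> continuous_on_vector_derivative by blast
  note conts = continuous_intros prim_continuous q_cont \<eta>c \<eta>' W
  have "W x - \<eta> x = prim (prim (\<lambda>s. q s * (W s - \<eta> s))) x" if "x \<in> {-b..b}" for x
  proof -
    from that have x: "\<bar>x\<bar> \<le> b" by auto
    have "prim (\<lambda>y. \<eta>' y - prim (\<lambda>s. q s * \<eta> s) y + prim (\<lambda>s. q s * W s) y) x
        = prim (\<lambda>y. \<eta>' y + prim (\<lambda>s. q s * (W s - \<eta> s)) y) x"
    proof (rule prim_cong[OF x])
      fix y assume "y \<in> {-b..b}"
      then have y: "\<bar>y\<bar> \<le> b" by auto
      have "prim (\<lambda>s. q s * (W s - \<eta> s)) y = prim (\<lambda>s. q s * W s) y - prim (\<lambda>s. q s * \<eta> s) y"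
        using prim_diff[of b "\<lambda>s. q s * W s" "\<lambda>s. q s * \<eta> s", OF _ _ y]
        by (simp add: right_diff_distrib conts)
      then show "\<eta>' y - prim (\<lambda>s. q s * \<eta> s) y + prim (\<lambda>s. q s * W s) y
          = \<eta>' y + prim (\<lambda>s. q s * (W s - \<eta> s)) y" by simp
    qed
    also have "\<dots> = prim \<eta>' x + prim (prim (\<lambda>s. q s * (W s - \<eta> s))) x"
      by (rule prim_add[OF _ _ x]) (intro conts)+
    finally show ?thesis using eq[OF that] prim_derivative[OF \<eta> \<eta>' x] by simp
  qed
  from double_prim_unique[OF b_pos q_cont _ this x] show ?thesis
    by (simp add: continuous_on_diff W \<eta>c)
qed

text \<open>
  Differentiating the resolvent of a Volterra equation is avoided by guessing the derivative: the
  right-hand side \<open>\<Phi>\<close> is continuous, because \<open>G2\<close> is invertible on continuous functions. The function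
  \<open>g\<close> with \<open>g(0) = \<eta>(0)\<close> and \<open>g' = \<Phi>\<close> is \<open>C\<^sup>1\<close>, and by \<open>G_eq_prim\<close> its image under \<open>G1\<close> satisfies the
  same integral equation as \<open>\<eta>\<close>. So that image is \<open>\<eta>\<close>, and \<open>g\<close> is the preimage.
\<close>

lemma G1_inv_derivative:
  assumes \<eta>: "\<And>s. s \<in> {-b..b} \<Longrightarrow> (\<eta> has_vector_derivative \<eta>' s) (at s within {-b..b})"
    and \<eta>': "continuous_on {-b..b} \<eta>'" and x: "x \<in> {-b..b}"
  defines "w \<equiv> \<lambda>x. \<eta>' x - \<eta>' 0 - prim (\<lambda>s. q s * \<eta> s) x"
  shows "(G1_inv b (kernel_K H) \<eta> has_vector_derivative
    G2_inv b (kernel_K H) w x + (\<eta>' 0 - h * \<eta> 0)) (at x within {-b..b})"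
proof -
  define c where "c = \<eta>' 0 - h * \<eta> 0"
  have \<eta>c: "continuous_on {-b..b} \<eta>" using \<eta> continuous_on_vector_derivative by blast
  have "continuous_on {-b..b} w"
    unfolding w_def by (intro continuous_intros prim_continuous q_cont \<eta>c \<eta>')
  then obtain \<xi> where \<xi>: "continuous_on {-b..b} \<xi>" "\<And>x. x \<in> {-b..b} \<Longrightarrow> G2 (kernel_K H) \<xi> x = w x"
    using G2_surj by blast
  define \<Phi> where "\<Phi> = (\<lambda>s. \<xi> s + c)"
  define g where "g = (\<lambda>s. \<eta> 0 + prim \<Phi> s)"
  \<comment> \<open>G1 applies G_plus to g - g(0) / 2; this function has the same derivative as g but half its
    initial value.\<close>
  define k where "k = (\<lambda>s. \<eta> 0 / 2 + prim \<Phi> s)"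
  have \<Phi>: "continuous_on {-b..b} \<Phi>" unfolding \<Phi>_def by (intro continuous_intros \<xi>)
  have G\<Phi>: "G (- 1) \<Phi> y = w y + c" if "y \<in> {-b..b}" for y
    using G2_eq[OF \<Phi> that] G2_add_const[of "kernel_K H" \<xi> c y] \<xi>(2)[OF that] by (simp add: \<Phi>_def)
  have g: "(g has_vector_derivative \<Phi> y) (at y within {-b..b})"
    and k: "(k has_vector_derivative \<Phi> y) (at y within {-b..b})" if "y \<in> {-b..b}" for y
    using prim_has_vector_derivative[OF \<Phi> that] unfolding g_def k_def
    by (auto intro!: derivative_eq_intros)
  have gc: "continuous_on {-b..b} g" and kc: "continuous_on {-b..b} k"
    using g k continuous_on_vector_derivative by blast+
  have k_eq: "k = (\<lambda>s. g s - g 0 / 2)" by (simp add: k_def g_def fun_eq_iff)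
  define W where "W = (\<lambda>x. G 1 k x + \<eta> 0 / 2)"
  have W: "G1 (kernel_K H) g x = W x" if "x \<in> {-b..b}" for x
    by (simp add: G1_eq[OF gc that] W_def k_eq) (simp add: g_def)
  have "W x = \<eta> x" if "x \<in> {-b..b}" for x
  proof (rule eq_if_same_double_prim[OF \<eta> \<eta>' _ _ that])
    show "continuous_on {-b..b} W" unfolding W_def by (intro continuous_intros G_cont kc) auto
    fix x assume "x \<in> {-b..b}"
    then have x: "\<bar>x\<bar> \<le> b" by auto
    have "G 1 k x = k 0 + prim (\<lambda>y. G (- 1) \<Phi> y + prim (\<lambda>s. q s * G 1 k s) y
        + k 0 * (h + 1 * h + 1 * prim q y)) x"
      by (rule G_eq_prim[OF k \<Phi> x])
    also have "prim (\<lambda>y. G (- 1) \<Phi> y + prim (\<lambda>s. q s * G 1 k s) y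
        + k 0 * (h + 1 * h + 1 * prim q y)) x
        = prim (\<lambda>y. \<eta>' y - prim (\<lambda>s. q s * \<eta> s) y + prim (\<lambda>s. q s * W s) y) x"
    proof (rule prim_cong[OF x])
      fix y assume y: "y \<in> {-b..b}"
      have "prim (\<lambda>s. q s * W s) y = prim (\<lambda>s. q s * G 1 k s + q s * (\<eta> 0 / 2)) y"
        by (simp add: W_def distrib_left)
      also have "\<dots> = prim (\<lambda>s. q s * G 1 k s) y + prim q y * (\<eta> 0 / 2)"
        using y by (subst prim_add[of b]) (auto intro!: continuous_intros q_cont G_cont kc)
      finally show "G (- 1) \<Phi> y + prim (\<lambda>s. q s * G 1 k s) y + k 0 * (h + 1 * h + 1 * prim q y)
          = \<eta>' y - prim (\<lambda>s. q s * \<eta> s) y + prim (\<lambda>s. q s * W s) y"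
        unfolding G\<Phi>[OF y] by (simp add: w_def c_def k_def field_simps)
    qed
    finally show "W x = \<eta> 0 + prim (\<lambda>y. \<eta>' y - prim (\<lambda>s. q s * \<eta> s) y + prim (\<lambda>s. q s * W s) y) x"
      by (simp add: W_def k_def)
  qed
  then have inv: "G1_inv b (kernel_K H) \<eta> s = g s" if "s \<in> {-b..b}" for s
    using G1_inv_eq[OF gc _ that] W by simp
  have "(G1_inv b (kernel_K H) \<eta> has_vector_derivative \<Phi> x) (at x within {-b..b})"
    by (rule has_vector_derivative_transform[OF x inv g[OF x]])
  then show ?thesis using G2_inv_eq[OF \<xi> x] by (simp add: \<Phi>_def c_def)
qed

text \<open>
  As for \<open>G1_inv\<close>, now with \<open>g(0) = \<eta>(0) = 0\<close>, so that the term with \<open>g(0)\<close> in \<open>G_eq_prim\<close> vanishes.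
  The commutation relation produces \<open>G_plus\<close>, whereas the claim is about \<open>G1\<close>; since the preimage \<open>\<xi>\<close>
  of \<open>w\<close> has the value \<open>2 \<eta>'(0)\<close> at \<open>0\<close>, the shift by \<open>\<eta>'(0)\<close> is exactly the one in the definition of
  \<open>G1\<close>.
\<close>

lemma G2_inv_derivative:
  assumes \<eta>: "\<And>s. s \<in> {-b..b} \<Longrightarrow> (\<eta> has_vector_derivative \<eta>' s) (at s within {-b..b})"
    and \<eta>': "continuous_on {-b..b} \<eta>'" and \<eta>0: "\<eta> 0 = 0" and x: "x \<in> {-b..b}"
  defines "w \<equiv> \<lambda>x. \<eta>' x + \<eta>' 0 - prim (\<lambda>s. q s * \<eta> s) x"
  shows "(G2_inv b (kernel_K H) \<eta> has_vector_derivative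
    G1_inv b (kernel_K H) w x - \<eta>' 0) (at x within {-b..b})"
proof -
  have \<eta>c: "continuous_on {-b..b} \<eta>" using \<eta> continuous_on_vector_derivative by blast
  have "continuous_on {-b..b} w"
    unfolding w_def by (intro continuous_intros prim_continuous q_cont \<eta>c \<eta>')
  then obtain \<xi> where \<xi>: "continuous_on {-b..b} \<xi>" "\<And>x. x \<in> {-b..b} \<Longrightarrow> G1 (kernel_K H) \<xi> x = w x"
    using G1_surj by blast
  have \<xi>0: "\<xi> 0 / 2 = \<eta>' 0"
    using \<xi>(2)[OF zero_mem] by (simp add: G1_eq[OF \<xi>(1) zero_mem] w_def)
  define g where "g = prim (\<lambda>s. \<xi> s - \<eta>' 0)"
  have \<Phi>: "continuous_on {-b..b} (\<lambda>s. \<xi> s - \<eta>' 0)" by (intro continuous_intros \<xi>)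
  have G\<Phi>: "G 1 (\<lambda>s. \<xi> s - \<eta>' 0) y = w y - \<eta>' 0" if "y \<in> {-b..b}" for y
    using G1_eq[OF \<xi>(1) that] \<xi>(2)[OF that] by (simp add: \<xi>0)
  have g: "(g has_vector_derivative \<xi> y - \<eta>' 0) (at y within {-b..b})" if "y \<in> {-b..b}" for y
    unfolding g_def by (rule prim_has_vector_derivative[OF \<Phi> that])
  have gc: "continuous_on {-b..b} g" unfolding g_def by (rule prim_continuous[OF \<Phi>])
  have g0: "g 0 = 0" by (simp add: g_def)
  have "G (- 1) g x = \<eta> x" if "x \<in> {-b..b}" for x
  proof (rule eq_if_same_double_prim[OF \<eta> \<eta>' G_cont[OF gc] _ that])
    fix x assume "x \<in> {-b..b}"
    then have x: "\<bar>x\<bar> \<le> b" by auto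
    have "G (- 1) g x = g 0 + prim (\<lambda>y. G (- (- 1)) (\<lambda>s. \<xi> s - \<eta>' 0) y + prim (\<lambda>s. q s * G (- 1) g s) y
        + g 0 * (h + (- 1) * h + (- 1) * prim q y)) x"
      by (rule G_eq_prim[OF g \<Phi> x])
    also have "prim (\<lambda>y. G (- (- 1)) (\<lambda>s. \<xi> s - \<eta>' 0) y + prim (\<lambda>s. q s * G (- 1) g s) y
        + g 0 * (h + (- 1) * h + (- 1) * prim q y)) x
        = prim (\<lambda>y. \<eta>' y - prim (\<lambda>s. q s * \<eta> s) y + prim (\<lambda>s. q s * G (- 1) g s) y) x"
      by (rule prim_cong[OF x]) (simp add: G\<Phi> g0 w_def)
    finally show "G (- 1) g x
        = \<eta> 0 + prim (\<lambda>y. \<eta>' y - prim (\<lambda>s. q s * \<eta> s) y + prim (\<lambda>s. q s * G (- 1) g s) y) x"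
      by (simp add: g0 \<eta>0)
  qed
  then have inv: "G2_inv b (kernel_K H) \<eta> s = g s" if "s \<in> {-b..b}" for s
    using G2_inv_eq[OF gc _ that] G2_eq[OF gc] by simp
  have "(G2_inv b (kernel_K H) \<eta> has_vector_derivative \<xi> x - \<eta>' 0) (at x within {-b..b})"
    by (rule has_vector_derivative_transform[OF x inv g[OF x]])
  then show ?thesis using G1_inv_eq[OF \<xi> x] by simp
qed

end

section \<open>Higher derivatives\<close>

lemma D_eq:
  assumes "0 < b" "x \<in> {-b..b}" "(g has_vector_derivative d) (at x within {-b..b})"
  shows "D b g x = d"
  unfolding D_def using assms by (intro vector_derivative_within_closed_interval) auto

lemma C_diff_1_has_vector_derivative:
  assumes "C_diff b 1 g" "x \<in> {-b..b}"
  shows "(g has_vector_derivative D b g x) (at x within {-b..b})"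
  using assms unfolding C_diff_def D_def differentiable_on_def
  by (simp add: vector_derivative_works[symmetric])

lemma C_diff_1_D_continuous: "C_diff b 1 g \<Longrightarrow> continuous_on {-b..b} (D b g)"
  by (simp add: C_diff_def)

text \<open>
  The additive constant absorbs the constants that the induction below accumulates.
\<close>

lemma C_diff_Suc:
  assumes b: "0 < b" and g: "C_diff b n g"
    and eq: "\<And>x. x \<in> {-b..b} \<Longrightarrow> (D b ^^ n) g x = F x + c"
    and F: "\<And>x. x \<in> {-b..b} \<Longrightarrow> (F has_vector_derivative F' x) (at x within {-b..b})"
    and F': "continuous_on {-b..b} F'"
  shows "C_diff b (Suc n) g \<and> (\<forall>x\<in>{-b..b}. (D b ^^ Suc n) g x = F' x)"
proof -
  have deriv: "((D b ^^ n) g has_vector_derivative F' x) (at x within {-b..b})" if "x \<in> {-b..b}" for x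
  proof (rule has_vector_derivative_transform[OF that eq])
    show "((\<lambda>x. F x + c) has_vector_derivative F' x) (at x within {-b..b})"
      using has_vector_derivative_add[OF F[OF that] has_vector_derivative_const] by simp
  qed
  then have D_eq': "(D b ^^ Suc n) g x = F' x" if "x \<in> {-b..b}" for x
    using D_eq[OF b that] that by simp
  moreover have "continuous_on {-b..b} ((D b ^^ Suc n) g)"
    using D_eq' by (intro continuous_on_eq[OF F']) simp
  moreover have "(D b ^^ n) g differentiable_on {-b..b}"
    unfolding differentiable_on_def using deriv differentiableI_vector by blast
  ultimately show ?thesis
    using g by (auto simp: C_diff_def less_Suc_eq)
qed

lemma gamma21_at_0 [simp]: "gamma21 b q g 0 = 0"
  by (simp add: gamma21_def)

text \<open>
  The formula for the derivative of \<open>G2_inv\<close> needs a function that vanishes at \<open>0\<close>. The terms of the two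
  sequences to which it is applied do so.
\<close>

lemma u_seq_odd_at_0: "odd n \<Longrightarrow> u_seq b q \<eta> n 0 = 0"
  by (cases n) auto

lemma v_seq_even_at_0: "even n \<Longrightarrow> v_seq b q \<eta> n 0 = 0"
  by (cases n) auto

text \<open>
  This is where the term \<open>2 h v\<^sub>n\<^sub>-\<^sub>2'(0)\<close> comes from: differentiating \<open>G1_inv\<close> at an odd stage produces
  \<open>h\<close> times the value at \<open>0\<close>.
\<close>

lemma v_seq_odd_at_0: "odd n \<Longrightarrow> v_seq b q \<eta> n 0 = 2 * D b (v_seq b q \<eta> (n - 1)) 0"
  by (cases n) auto

context goursat
begin

lemma C_diff_1_continuous: "C_diff b 1 g \<Longrightarrow> continuous_on {-b..b} g"
  using C_diff_1_has_vector_derivative continuous_on_vector_derivative by blast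

lemma gamma21_continuous:
  assumes "C_diff b 1 g"
  shows "continuous_on {-b..b} (gamma21 b q g)"
  unfolding gamma21_def
  by (intro continuous_intros prim_continuous q_cont C_diff_1_continuous C_diff_1_D_continuous assms) auto

lemma u_seq_continuous:
  assumes "continuous_on {-b..b} \<eta>" "\<And>j. j < n \<Longrightarrow> C_diff b 1 (u_seq b q \<eta> j)"
  shows "continuous_on {-b..b} (u_seq b q \<eta> n)"
  using assms by (cases n) (auto intro!: continuous_intros gamma21_continuous)

lemma v_seq_continuous:
  assumes "continuous_on {-b..b} \<eta>" "\<And>j. j < n \<Longrightarrow> C_diff b 1 (v_seq b q \<eta> j)"
  shows "continuous_on {-b..b} (v_seq b q \<eta> n)"
  using assms by (cases n) (auto intro!: continuous_intros gamma21_continuous)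

abbreviation "G1i \<equiv> G1_inv b (kernel_K H)"
abbreviation "G2i \<equiv> G2_inv b (kernel_K H)"

lemma G1_inv_derivative_gamma21:
  assumes \<eta>: "C_diff b 1 \<eta>" and x: "x \<in> {-b..b}"
  shows "(G1i \<eta> has_vector_derivative
    G2i (\<lambda>x. 2 * gamma21 b q \<eta> x) x + (D b \<eta> 0 - h * \<eta> 0)) (at x within {-b..b})"
proof -
  have "(\<lambda>x. 2 * gamma21 b q \<eta> x) = (\<lambda>x. D b \<eta> x - D b \<eta> 0 - prim (\<lambda>s. q s * \<eta> s) x)"
    by (simp add: gamma21_def fun_eq_iff)
  then show ?thesis
    using G1_inv_derivative[OF C_diff_1_has_vector_derivative[OF \<eta>] C_diff_1_D_continuous[OF \<eta>] x] by simp
qed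

lemma G2_inv_derivative_gamma21:
  assumes \<eta>: "C_diff b 1 \<eta>" and "\<eta> 0 = 0" and x: "x \<in> {-b..b}"
  shows "(G2i \<eta> has_vector_derivative
    G1i (\<lambda>x. 2 * gamma21 b q \<eta> x + 2 * D b \<eta> 0) x - D b \<eta> 0) (at x within {-b..b})"
proof -
  have "(\<lambda>x. 2 * gamma21 b q \<eta> x + 2 * D b \<eta> 0) = (\<lambda>x. D b \<eta> x + D b \<eta> 0 - prim (\<lambda>s. q s * \<eta> s) x)"
    by (simp add: gamma21_def fun_eq_iff field_simps)
  then show ?thesis
    using G2_inv_derivative[OF C_diff_1_has_vector_derivative[OF \<eta>] C_diff_1_D_continuous[OF \<eta>] assms(2) x]
    by simp
qed

text \<open>
  One further derivative of \<open>G1_inv (u n)\<close> gives \<open>G2_inv (u (Suc n))\<close> and vice versa, each time up to a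
  constant that the next derivative removes. The two rules of the recursion are the two formulas for
  these derivatives.
\<close>

lemma G1_inv_higher_derivatives:
  assumes \<eta>: "continuous_on {-b..b} \<eta>"
  defines "u \<equiv> u_seq b q \<eta>"
  assumes u: "\<And>j. j < n \<Longrightarrow> C_diff b 1 (u j)"
  shows "C_diff b n (G1i \<eta>) \<and> (\<forall>x\<in>{-b..b}. (D b ^^ n) (G1i \<eta>) x =
    (if n = 0 then G1i \<eta> x
     else if even n then G1i (u n) x - D b (u (n - 1)) 0
     else G2i (u n) x + D b (u (n - 1)) 0 - h * u (n - 1) 0))"
  using u
proof (induction n)
  case 0
  show ?case using G1_inv_cont[OF \<eta>] by (simp add: C_diff_def)
next
  case (Suc n)
  then have IH: "C_diff b n (G1i \<eta>)" "\<And>x. x \<in> {-b..b} \<Longrightarrow> (D b ^^ n) (G1i \<eta>) x =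
    (if n = 0 then G1i \<eta> x
     else if even n then G1i (u n) x - D b (u (n - 1)) 0
     else G2i (u n) x + D b (u (n - 1)) 0 - h * u (n - 1) 0)"
    by simp_all
  have un: "C_diff b 1 (u n)" using Suc.prems by simp
  have cont: "continuous_on {-b..b} (u (Suc n))"
    unfolding u_def by (rule u_seq_continuous[OF \<eta>]) (use Suc.prems in \<open>simp add: u_def\<close>)
  show ?case
  proof (cases "even n")
    case True
    define c where "c = (if n = 0 then 0 else - D b (u (n - 1)) 0)"
    have rec: "u (Suc n) = (\<lambda>x. 2 * gamma21 b q (u n) x)" using True by (simp add: u_def)
    have "C_diff b (Suc n) (G1i \<eta>) \<and> (\<forall>x\<in>{-b..b}. (D b ^^ Suc n) (G1i \<eta>) x
        = G2i (u (Suc n)) x + (D b (u n) 0 - h * u n 0))"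
    proof (rule C_diff_Suc[OF b_pos IH(1), where F = "G1i (u n)" and c = c])
      show "(D b ^^ n) (G1i \<eta>) x = G1i (u n) x + c" if "x \<in> {-b..b}" for x
        using IH(2)[OF that] True by (simp add: c_def u_def)
      show "(G1i (u n) has_vector_derivative G2i (u (Suc n)) x + (D b (u n) 0 - h * u n 0))
          (at x within {-b..b})" if "x \<in> {-b..b}" for x
        unfolding rec by (rule G1_inv_derivative_gamma21[OF un that])
      show "continuous_on {-b..b} (\<lambda>x. G2i (u (Suc n)) x + (D b (u n) 0 - h * u n 0))"
        by (intro continuous_intros G2_inv_cont cont)
    qed
    then show ?thesis using True by (simp add: add_diff_eq)
  next
    case False
    define c where "c = D b (u (n - 1)) 0 - h * u (n - 1) 0"
    have rec: "u (Suc n) = (\<lambda>x. 2 * gamma21 b q (u n) x + 2 * D b (u n) 0)"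
      using False by (simp add: u_def)
    have "C_diff b (Suc n) (G1i \<eta>) \<and> (\<forall>x\<in>{-b..b}. (D b ^^ Suc n) (G1i \<eta>) x
        = G1i (u (Suc n)) x - D b (u n) 0)"
    proof (rule C_diff_Suc[OF b_pos IH(1), where F = "G2i (u n)" and c = c])
      show "(D b ^^ n) (G1i \<eta>) x = G2i (u n) x + c" if "x \<in> {-b..b}" for x
        using IH(2)[OF that] False by (auto simp: c_def)
      show "(G2i (u n) has_vector_derivative G1i (u (Suc n)) x - D b (u n) 0)
          (at x within {-b..b})" if "x \<in> {-b..b}" for x
        unfolding rec by (rule G2_inv_derivative_gamma21[OF un _ that])
          (use False in \<open>simp add: u_def u_seq_odd_at_0\<close>)
      show "continuous_on {-b..b} (\<lambda>x. G1i (u (Suc n)) x - D b (u n) 0)"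
        by (intro continuous_intros G1_inv_cont cont)
    qed
    then show ?thesis using False by simp
  qed
qed

text \<open>
  The first step replaces \<open>\<eta>\<close> by \<open>v 0 = \<eta> - \<eta> 0\<close>: since \<open>G2\<close> preserves constants, this changes the
  preimage by a constant only.
\<close>

lemma G2_inv_higher_derivatives:
  assumes \<eta>: "continuous_on {-b..b} \<eta>"
  defines "v \<equiv> v_seq b q \<eta>"
  assumes v: "\<And>j. j < n \<Longrightarrow> C_diff b 1 (v j)"
  shows "C_diff b n (G2i \<eta>) \<and> (\<forall>x\<in>{-b..b}. (D b ^^ n) (G2i \<eta>) x =
    (if n = 0 then G2i \<eta> x
     else if even n then G2i (v n) x - 2 * h * D b (v (n - 2)) 0 + D b (v (n - 1)) 0
     else G1i (v n) x - D b (v (n - 1)) 0))"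
  using v
proof (induction n)
  case 0
  show ?case using G2_inv_cont[OF \<eta>] by (simp add: C_diff_def)
next
  case (Suc n)
  then have IH: "C_diff b n (G2i \<eta>)" "\<And>x. x \<in> {-b..b} \<Longrightarrow> (D b ^^ n) (G2i \<eta>) x =
    (if n = 0 then G2i \<eta> x
     else if even n then G2i (v n) x - 2 * h * D b (v (n - 2)) 0 + D b (v (n - 1)) 0
     else G1i (v n) x - D b (v (n - 1)) 0)"
    by simp_all
  have vn: "C_diff b 1 (v n)" using Suc.prems by simp
  have cont: "continuous_on {-b..b} (v (Suc n))"
    unfolding v_def by (rule v_seq_continuous[OF \<eta>]) (use Suc.prems in \<open>simp add: v_def\<close>)
  show ?case
  proof (cases "even n")
    case True
    define c where "c = (if n = 0 then \<eta> 0 else D b (v (n - 1)) 0 - 2 * h * D b (v (n - 2)) 0)"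
    have rec: "v (Suc n) = (\<lambda>x. 2 * gamma21 b q (v n) x + 2 * D b (v n) 0)"
      using True by (simp add: v_def)
    have "C_diff b (Suc n) (G2i \<eta>) \<and> (\<forall>x\<in>{-b..b}. (D b ^^ Suc n) (G2i \<eta>) x
        = G1i (v (Suc n)) x - D b (v n) 0)"
    proof (rule C_diff_Suc[OF b_pos IH(1), where F = "G2i (v n)" and c = c])
      show "(D b ^^ n) (G2i \<eta>) x = G2i (v n) x + c" if "x \<in> {-b..b}" for x
      proof (cases "n = 0")
        case True
        have "G2i (\<lambda>s. (\<eta> s - \<eta> 0) + \<eta> 0) x = G2i (\<lambda>s. \<eta> s - \<eta> 0) x + \<eta> 0"
          by (rule G2_inv_add_const[OF _ that]) (intro continuous_intros \<eta>)
        then show ?thesis using True by (simp add: c_def v_def)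
      next
        case False
        then show ?thesis using IH(2)[OF that] \<open>even n\<close> by (simp add: c_def)
      qed
      show "(G2i (v n) has_vector_derivative G1i (v (Suc n)) x - D b (v n) 0)
          (at x within {-b..b})" if "x \<in> {-b..b}" for x
        unfolding rec by (rule G2_inv_derivative_gamma21[OF vn _ that])
          (use True in \<open>simp add: v_def v_seq_even_at_0\<close>)
      show "continuous_on {-b..b} (\<lambda>x. G1i (v (Suc n)) x - D b (v n) 0)"
        by (intro continuous_intros G1_inv_cont cont)
    qed
    then show ?thesis using True by simp
  next
    case False
    define c where "c = - D b (v (n - 1)) 0"
    have rec: "v (Suc n) = (\<lambda>x. 2 * gamma21 b q (v n) x)" using False by (simp add: v_def)
    have "C_diff b (Suc n) (G2i \<eta>) \<and> (\<forall>x\<in>{-b..b}. (D b ^^ Suc n) (G2i \<eta>) x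
        = G2i (v (Suc n)) x + (D b (v n) 0 - h * v n 0))"
    proof (rule C_diff_Suc[OF b_pos IH(1), where F = "G1i (v n)" and c = c])
      show "(D b ^^ n) (G2i \<eta>) x = G1i (v n) x + c" if "x \<in> {-b..b}" for x
        using IH(2)[OF that] False by (auto simp: c_def)
      show "(G1i (v n) has_vector_derivative G2i (v (Suc n)) x + (D b (v n) 0 - h * v n 0))
          (at x within {-b..b})" if "x \<in> {-b..b}" for x
        unfolding rec by (rule G1_inv_derivative_gamma21[OF vn that])
      show "continuous_on {-b..b} (\<lambda>x. G2i (v (Suc n)) x + (D b (v n) 0 - h * v n 0))"
        by (intro continuous_intros G2_inv_cont cont)
    qed
    moreover have "v n 0 = 2 * D b (v (Suc n - 2)) 0"
      using v_seq_odd_at_0[OF False] by (simp add: v_def)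
    ultimately show ?thesis using False by (simp add: algebra_simps)
  qed
qed

end

theorem proposition6p7:
  fixes b :: real and q f f' \<eta> :: "real \<Rightarrow> complex" and h :: complex
    and H :: "real \<Rightarrow> real \<Rightarrow> complex" and n :: nat
  defines "K \<equiv> kernel_K H" and "u \<equiv> u_seq b q \<eta>" and "v \<equiv> v_seq b q \<eta>"
  assumes "b > 0"
    and "continuous_on {-b..b} q"
    and "\<And>x. x \<in> {-b..b} \<Longrightarrow> (f has_vector_derivative f' x) (at x within {-b..b})"
    and "\<And>x. x \<in> {-b..b} \<Longrightarrow> (f' has_vector_derivative q x * f x) (at x within {-b..b})"
    and "\<And>x. x \<in> {-b..b} \<Longrightarrow> f x \<noteq> 0"
    and "f 0 = 1" and "h = f' 0"
    and "goursat_solution b q h H"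
    and "n \<ge> 1"
    and "C_diff b 1 \<eta>"
    and "\<And>j. j < n \<Longrightarrow> C_diff b 1 (u j)"
    and "\<And>j. j < n \<Longrightarrow> C_diff b 1 (v j)"
  shows "C_diff b n (G1_inv b K \<eta>) \<and> C_diff b n (G2_inv b K \<eta>) \<and>
    (even n \<longrightarrow> (\<forall>x\<in>{-b..b}.
      (D b ^^ n) (G1_inv b K \<eta>) x = G1_inv b K (u n) x - D b (u (n - 1)) 0 \<and>
      (D b ^^ n) (G2_inv b K \<eta>) x =
        G2_inv b K (v n) x - 2 * h * D b (v (n - 2)) 0 + D b (v (n - 1)) 0)) \<and>
    (odd n \<longrightarrow> (\<forall>x\<in>{-b..b}.
      (D b ^^ n) (G2_inv b K \<eta>) x = G1_inv b K (v n) x - D b (v (n - 1)) 0 \<and>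
      (D b ^^ n) (G1_inv b K \<eta>) x =
        G2_inv b K (u n) x + D b (u (n - 1)) 0 - h * u (n - 1) 0))"
proof -
  interpret goursat b q h H
    using assms by unfold_locales auto
  have \<eta>: "continuous_on {-b..b} \<eta>" using C_diff_1_continuous assms by blast
  show ?thesis
    using G1_inv_higher_derivatives[OF \<eta>, of n] G2_inv_higher_derivatives[OF \<eta>, of n] assms
    by auto
qed

end
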